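(* If the system $X_{t+1}=AX_t+BU_t+W_t$ is mean square stable over the parallel network (for some choice of encoder, relay and controller policies and relay powers satisfying the constraints of the network), then $$\log\left(|\det(A)|\right)\le\frac14\min\left\{\log\left(1+2\sum_{i=1}^{L}\frac{P_S}{N_r^i}\right),\ \sum_{i=1}^{L}\log\left(1+\frac{2P_r^i}{N_d^i}\right)\right\},$$ where $P_r^i=\max\{\gamma-N_d^i/2,\,0\}$ and $\gamma$ is chosen such that $\sum_{i=1}^LP_r^i=P_R$.
   Context: Notation: $\mathbb N=\{0,1,2,\dots\}$, $X_{[0,t]}=(X_0,\dots,X_t)$, $\log$ is base 2, $h(\cdot)$ is differential entropy. Plant: $X_{t+1}=AX_t+BU_t+W_t$, $t\in\mathbb N$, with state $X_t\in\mathbb R^n$, control $U_t\in\mathbb R^m$, plant noise $W_t\in\mathbb R^n$. The initial state $X_0$ is a random vector with $|h(X_0)|<\infty$ and a given covariance matrix $\Lambda_0$. $\{W_t\}$ is a zero-mean white (i.i.d.) Gaussian sequence with covariance $K_W$, independent of $X_0$. The pair $(A,B)$ is controllable and all eigenvalues $\lambda_i$ of $A$ satisfy $|\lambda_i|\ge 1$. The system is mean square stable if there is a constant $M<\infty$ with $\mathbb E[\|X_t\|^2]<M$ for all $t$. Parallel network: a state encoder, $L$ relays $\mathcal R_1,\dots,\mathcal R_L$, and a remote controller that receives the $L$ relay signals over $L$ separate channels. - For $t=1,3,5,\dots$: the encoder sends $S_{e,t}=f_t(X_{[0,t]},U_{[0,t-1]})$ with $\mathbb E[S_{e,t}^2]=2P_S$;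 relay $i$ receives $Y^i_t=S_{e,t}+Z^i_{r,t}$; and $S^i_{r,t}=R^i_t=0$. - For $t=2,4,6,\dots$: relay $i$ sends $S^i_{r,t}=g^i_t(Y^i_{[0,t-1]})$ with $\mathbb E[(S^i_{r,t})^2]=2P_r^i$; the controller receives $R^i_t=S^i_{r,t}+Z^i_{d,t}$, $i=1,\dots,L$; and $S_{e,t}=Y^i_t=0$. The relay powers satisfy $\sum_{i=1}^LP_r^i\le P_R$. The controller applies $U_t=\pi_t(\{R^i_{[0,t]}\}_{i=1}^L)$. The noises $Z^i_{r,t}\sim\mathcal N(0,N_r^i)$ and $Z^i_{d,t}\sim\mathcal N(0,N_d^i)$ are mutually independent, white, and independent of $X_0$ and $\{W_t\}$. All functions $f_t,g^i_t,\pi_t$ are arbitrary. *)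

theory Defs
  imports "HOL-Probability.Probability"
begin

text \<open>Controllability of the noise-free system: every state can be steered to every other state
  in finite time.\<close>

primrec trajectory ::
  "real^'n^'n \<Rightarrow> real^'m^'n \<Rightarrow> (nat \<Rightarrow> real^'m) \<Rightarrow> real^'n \<Rightarrow> nat \<Rightarrow> real^'n" where
  "trajectory A B u x 0 = x"
| "trajectory A B u x (Suc t) = A *v trajectory A B u x t + B *v u t"

definition controllable :: "real^'n^'n \<Rightarrow> real^'m^'n \<Rightarrow> bool" where
  "controllable A B \<longleftrightarrow> (\<forall>x y. \<exists>u T. trajectory A B u x T = y)"

definition complex_eigenvalue :: "real^'n^'n \<Rightarrow> complex \<Rightarrow> bool" where
  "complex_eigenvalue A z \<longleftrightarrow>
     (\<exists>v::complex^'n. v \<noteq> 0 \<and> map_matrix complex_of_real A *v v = z *s v)"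

definition has_covariance :: "'a measure \<Rightarrow> ('a \<Rightarrow> real^'n) \<Rightarrow> real^'n^'n \<Rightarrow> bool" where
  "has_covariance M X K \<longleftrightarrow>
     X \<in> borel_measurable M \<and>
     (\<forall>i. integrable M (\<lambda>w. (X w $ i)\<^sup>2)) \<and>
     (\<forall>i j. K $ i $ j =
        (\<integral>w. (X w $ i - (\<integral>v. X v $ i \<partial>M)) * (X w $ j - (\<integral>v. X v $ j \<partial>M)) \<partial>M))"

text \<open>Zero-mean Gaussian vectors are those whose scalar projections are all centred normal.
  The case \<open>\<sigma> = 0\<close> (a point mass) is included, so that covariance matrices may be singular.\<close>

definition zero_mean_gaussian_vector :: "'a measure \<Rightarrow> ('a \<Rightarrow> real^'n) \<Rightarrow> bool" where
  "zero_mean_gaussian_vector M X \<longleftrightarrow>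
     X \<in> borel_measurable M \<and>
     (\<forall>a. \<exists>\<sigma>\<ge>0. distr M borel (\<lambda>w. a \<bullet> X w) =
        (if \<sigma> = 0 then return borel 0 else density lborel (normal_density 0 \<sigma>)))"

text \<open>\<open>|h(X)| < \<infinity>\<close>. The library's entropy is a Bochner integral and hence always a real
  number, so finiteness is expressed by a Lebesgue density \<open>p\<close> with \<open>p log p\<close> integrable.\<close>

definition finite_differential_entropy ::
  "'a measure \<Rightarrow> ('a \<Rightarrow> 'b::euclidean_space) \<Rightarrow> bool" where
  "finite_differential_entropy M X \<longleftrightarrow>
     (\<exists>p. information_space.finite_entropy M 2 lborel X p)"

text \<open>The primitive random variables have different value types, so their joint independence
  is stated for the families of events that they generate (as \<open>indep_vars\<close> does
  for a single value type).\<close>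

datatype 'l source = Initial | Plant nat | Relay_noise 'l nat | Dest_noise 'l nat

definition generated_events ::
  "'a measure \<Rightarrow> ('a \<Rightarrow> 'b::topological_space) \<Rightarrow> 'a set set" where
  "generated_events M X = {X -` E \<inter> space M | E. E \<in> sets borel}"

definition independent_sources ::
  "'a measure \<Rightarrow> ('a \<Rightarrow> real^'n) \<Rightarrow> (nat \<Rightarrow> 'a \<Rightarrow> real^'n) \<Rightarrow>
   ('l \<Rightarrow> nat \<Rightarrow> 'a \<Rightarrow> real) \<Rightarrow> ('l \<Rightarrow> nat \<Rightarrow> 'a \<Rightarrow> real) \<Rightarrow> bool" where
  "independent_sources M X0 W Zr Zd \<longleftrightarrow>
     prob_space.indep_sets M
       (\<lambda>s. case s of
          Initial \<Rightarrow> generated_events M X0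
        | Plant t \<Rightarrow> generated_events M (W t)
        | Relay_noise i t \<Rightarrow> generated_events M (Zr i t)
        | Dest_noise i t \<Rightarrow> generated_events M (Zd i t)) UNIV"

text \<open>The nonnegative integral makes the bound include the existence of the second moments.\<close>

definition mean_square_stable :: "'a measure \<Rightarrow> (nat \<Rightarrow> 'a \<Rightarrow> real^'n) \<Rightarrow> bool" where
  "mean_square_stable M X \<longleftrightarrow>
     (\<exists>c::real. \<forall>t. (\<integral>\<^sup>+w. ennreal ((norm (X t w))\<^sup>2) \<partial>M) < ennreal c)"

end

theory Submission
  imports Defs
begin

text \<open>
  Stability makes the outputs of either hop determine the initial state up to an error
  \<open>A\<^sup>-\<^sup>t X t\<close>, where \<open>X t\<close> has bounded second moment. This is turned into a bound without any
  information measures. Compare the joint law of the initial state and the hop's outputs with a reference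
  law: i.i.d. Gaussian outputs with the capacity-achieving covariance and, given the outputs, a Gaussian
  initial state around the controller's estimate. The likelihood ratio \<open>L\<close> of the reference law to the
  true one has expectation at most 1, so \<open>ln L \<le> L - 1\<close> gives \<open>E (ln L) \<le> 0\<close>. Here \<open>E (ln L)\<close> is
  \<open>t ln |det A|\<close> minus \<open>t / 2\<close> times the capacity of one use of the hop, up to a bounded term; let \<open>t\<close> tend
  to infinity. The noises of the hop in question are the channel noise, everything else is side
  information.
\<close>

section \<open>Lebesgue measure on vectors\<close>

text \<open>The obstacle is feedback: a channel input may depend on all earlier outputs through
  arbitrary measurable policies, so nothing explicit is known about the joint law of the outputs. Of
  the true law, only two densities are ever used, that of the noise in one use of the hop and that
  of the initial state. Each cancels against a denominator of the likelihood ratio, and a shift by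
  the channel input leaves a Lebesgue integral unchanged, so the policies drop out one use at a
  time. The inputs need not be Gaussian: the logarithm of a Gaussian density is quadratic, so its
  mean sees second moments only, and the power constraints fix these. Each hop is used once in two
  plant steps, so \<open>K\<close> uses are compared with \<open>2 * K\<close> steps; one use is
  worth half a logarithm, and together this gives the factor 1/4. On the first hop all relays hear
  the same symbol, a rank-one signal in independent noises, which puts the sum over the relays
  inside the logarithm. On the second hop the channels are parallel, which puts it outside.\<close>

lemma measurable_vec_lambda [measurable (raw)]:
  fixes f :: "'a \<Rightarrow> 'i::finite \<Rightarrow> real"
  assumes "\<And>i. (\<lambda>x. f x i) \<in> borel_measurable M"
  shows "(\<lambda>x. \<chi> i. f x i) \<in> borel_measurable M"
proof (subst borel_measurable_euclidean_space, intro ballI)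
  fix b :: "real^'i" assume "b \<in> Basis"
  then obtain i where "b = axis i 1"
    by (auto simp: Basis_vec_def)
  then show "(\<lambda>x. (\<chi> i. f x i) \<bullet> b) \<in> borel_measurable M"
    using assms by (simp add: inner_axis)
qed

lemma measurable_vec_nth_compose [measurable (raw)]:
  fixes f :: "'a \<Rightarrow> real^'i"
  assumes "f \<in> borel_measurable M"
  shows "(\<lambda>x. f x $ i) \<in> borel_measurable M"
proof -
  have "(\<lambda>x. f x \<bullet> axis i 1) \<in> borel_measurable M"
    using assms by measurable
  then show ?thesis by (simp add: inner_axis)
qed

lemma Basis_vec_real: "(Basis :: (real^'i) set) = range (\<lambda>i. axis i 1)"
  by (auto simp: Basis_vec_def)

lemma inj_axis_1: "inj (\<lambda>i::'i::finite. axis i (1::real))"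
  by (auto simp: inj_on_def axis_eq_axis)

lemma prod_Basis_vec:
  fixes h :: "real^'i \<Rightarrow> 'b::comm_monoid_mult"
  shows "(\<Prod>b\<in>Basis. h b) = (\<Prod>i\<in>UNIV. h (axis i 1))"
  unfolding Basis_vec_real by (subst prod.reindex[OF inj_axis_1]) simp

lemma emeasure_lborel_box_vec:
  fixes l u :: "real^'i"
  assumes "\<And>i. l $ i \<le> u $ i"
  shows "emeasure lborel (box l u) = ennreal (\<Prod>i\<in>UNIV. u $ i - l $ i)"
proof -
  have "emeasure lborel (box l u) = ennreal (\<Prod>b\<in>Basis. (u - l) \<bullet> b)"
    using assms by (intro emeasure_lborel_box) (auto simp: Basis_vec_real inner_axis)
  then show ?thesis
    by (simp add: prod_Basis_vec inner_axis)
qed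

interpretation lborel_product: product_sigma_finite "\<lambda>_::'i. lborel :: real measure"
  by standard

text \<open>Both measures agree on boxes, which determines them. This makes Fubini over single
  coordinates available for vectors.\<close>

lemma lborel_vec:
  "lborel = distr (PiM UNIV (\<lambda>_::'i::finite. lborel)) borel (\<lambda>x. (\<chi> i. x i) :: real^'i)"
proof (rule lborel_eqI)
  fix l u :: "real^'i"
  assume le: "\<And>b. b \<in> Basis \<Longrightarrow> l \<bullet> b \<le> u \<bullet> b"
  have le': "l $ i \<le> u $ i" for i
    using le[of "axis i 1"] by (simp add: inner_axis axis_in_Basis_iff)
  have eq: "(\<lambda>x. \<chi> i. x i) -` box l u \<inter> space (PiM UNIV (\<lambda>_::'i. lborel)) =
      (\<Pi>\<^sub>E i\<in>UNIV. {l $ i<..<u $ i})"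
    by (auto simp: space_PiM mem_box_cart PiE_iff)
  have "emeasure (distr (PiM UNIV (\<lambda>_::'i. lborel)) borel (\<lambda>x. (\<chi> i. x i) :: real^'i)) (box l u)
      = (\<Prod>i\<in>UNIV. ennreal (u $ i - l $ i))"
    by (subst emeasure_distr) (auto simp: eq lborel_product.emeasure_PiM le')
  then show "emeasure (distr (PiM UNIV (\<lambda>_::'i. lborel)) borel (\<lambda>x. (\<chi> i. x i) :: real^'i)) (box l u)
      = (\<Prod>b\<in>Basis. (u - l) \<bullet> b)"
    by (simp add: prod_Basis_vec inner_axis prod_ennreal le')
qed simp

lemma nn_integral_lborel_vec:
  fixes g :: "real^'i \<Rightarrow> ennreal"
  assumes [measurable]: "g \<in> borel_measurable borel"
  shows "(\<integral>\<^sup>+x. g x \<partial>lborel) = (\<integral>\<^sup>+x. g (\<chi> i. x i) \<partial>PiM UNIV (\<lambda>_. lborel))"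
  by (subst lborel_vec, subst nn_integral_distr) auto

lemma nn_integral_prod_vec:
  fixes h :: "'i::finite \<Rightarrow> real \<Rightarrow> real"
  assumes [measurable]: "\<And>i. h i \<in> borel_measurable borel" and "\<And>i x. 0 \<le> h i x"
  shows "(\<integral>\<^sup>+(x::real^'i). (\<Prod>i\<in>UNIV. h i (x $ i)) \<partial>lborel) = (\<Prod>i\<in>UNIV. \<integral>\<^sup>+x. h i x \<partial>lborel)"
proof -
  have "(\<integral>\<^sup>+(x::real^'i). (\<Prod>i\<in>UNIV. h i (x $ i)) \<partial>lborel)
      = (\<integral>\<^sup>+x. (\<Prod>i\<in>UNIV. ennreal (h i (x i))) \<partial>PiM UNIV (\<lambda>_::'i. lborel))"
    using assms(2) by (subst nn_integral_lborel_vec) (simp_all add: prod_ennreal)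
  also have "\<dots> = (\<Prod>i\<in>UNIV. \<integral>\<^sup>+x. h i x \<partial>lborel)"
    by (rule lborel_product.product_nn_integral_prod) auto
  finally show ?thesis .
qed

section \<open>Linear change of variables\<close>

lemma nn_integral_translate:
  fixes c :: "'b::euclidean_space"
  assumes [measurable]: "g \<in> borel_measurable borel"
  shows "(\<integral>\<^sup>+x. g (c + x) \<partial>lborel) = (\<integral>\<^sup>+x. g x \<partial>lborel)"
  by (subst lborel_distr_plus[of c, symmetric], subst nn_integral_distr) auto

lemma nn_integral_lborel_vec_coordinate:
  fixes g :: "real^'i \<Rightarrow> ennreal"
  assumes [measurable]: "g \<in> borel_measurable borel"
  shows "(\<integral>\<^sup>+x. g x \<partial>lborel)
    = (\<integral>\<^sup>+x. (\<integral>\<^sup>+y. g (\<chi> i. if i = m then y else x i) \<partial>lborel) \<partial>PiM (UNIV - {m}) (\<lambda>_. lborel))"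
proof -
  have U: "insert m (UNIV - {m}) = UNIV" by auto
  show ?thesis
    using lborel_product.product_nn_integral_insert[of "UNIV - {m}" m "\<lambda>x. g (\<chi> i. x i)"]
    unfolding U by (simp add: nn_integral_lborel_vec fun_upd_def)
qed

text \<open>With the other coordinates fixed, a shear only translates coordinate \<open>m\<close> by
  a constant, so that coordinate is integrated first.\<close>

lemma nn_integral_lborel_shear:
  fixes g :: "real^'i \<Rightarrow> ennreal"
  assumes [measurable]: "g \<in> borel_measurable borel" and "m \<noteq> n"
  shows "(\<integral>\<^sup>+x. g (\<chi> i. if i = m then x $ m + x $ n else x $ i) \<partial>lborel) = (\<integral>\<^sup>+x. g x \<partial>lborel)"
proof -
  let ?h = "\<lambda>x::real^'i. \<chi> i. if i = m then x $ m + x $ n else x $ i"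
  have [measurable]: "?h \<in> borel_measurable borel"
    by (intro measurable_vec_lambda) (auto intro!: measurable_If)
  have "(\<integral>\<^sup>+y. g (?h (\<chi> i. if i = m then y else x i)) \<partial>lborel)
      = (\<integral>\<^sup>+y. g (\<chi> i. if i = m then y else x i) \<partial>lborel)" for x
  proof -
    have "(\<lambda>y. g (\<chi> i. if i = m then y else x i)) \<in> borel_measurable borel"
      by measurable
    moreover have "?h (\<chi> i. if i = m then y else x i) = (\<chi> i. if i = m then x n + y else x i)" for y
      using \<open>m \<noteq> n\<close> by (auto simp: vec_eq_iff)
    ultimately show ?thesis
      using nn_integral_translate[of "\<lambda>y. g (\<chi> i. if i = m then y else x i)" "x n"] by simp
  qed
  then show ?thesis
    by (subst (1 2) nn_integral_lborel_vec_coordinate[where m=m]) simp_all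
qed

lemma nn_integral_lborel_stretch:
  fixes g :: "real^'i \<Rightarrow> ennreal"
  assumes [measurable]: "g \<in> borel_measurable borel" and nz: "\<And>i. c i \<noteq> 0"
  shows "ennreal (\<Prod>i\<in>UNIV. \<bar>c i\<bar>) * (\<integral>\<^sup>+x. g (\<chi> i. c i * x $ i) \<partial>lborel) = (\<integral>\<^sup>+x. g x \<partial>lborel)"
proof -
  \<comment> \<open>The affine change of variables takes its scaling factors indexed by basis
    vectors; \<open>d\<close> carries \<open>c\<close> over to them.\<close>
  define d :: "real^'i \<Rightarrow> real" where "d b = c (THE i. b = axis i 1)" for b
  have d: "d (axis i 1) = c i" for i
    by (simp add: d_def axis_eq_axis)
  have sumB: "(\<Sum>j\<in>Basis. (d j * (x \<bullet> j)) *\<^sub>R j) = (\<chi> i. c i * x $ i)" for x :: "real^'i"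
  proof -
    have "(\<Sum>j\<in>Basis. (d j * (x \<bullet> j)) *\<^sub>R j) = (\<Sum>i\<in>UNIV. (c i * x $ i) *\<^sub>R axis i 1)"
      unfolding Basis_vec_real by (subst sum.reindex[OF inj_axis_1]) (simp add: d inner_axis)
    also have "\<dots> = (\<chi> i. c i * x $ i)"
      by (simp add: vec_eq_iff axis_def if_distrib cong: if_cong)
    finally show ?thesis .
  qed
  have "lborel = density (distr lborel borel (\<lambda>x. 0 + (\<Sum>j\<in>Basis. (d j * (x \<bullet> j)) *\<^sub>R j)))
      (\<lambda>_. \<Prod>j\<in>Basis. \<bar>d j\<bar>)"
    by (rule lborel_affine_euclidean) (auto simp: Basis_vec_def d nz)
  then have lb: "lborel = density (distr lborel borel (\<lambda>x. \<chi> i. c i * x $ i)) (\<lambda>_. \<Prod>i\<in>UNIV. \<bar>c i\<bar>)"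
    by (simp add: sumB prod_Basis_vec d)
  have "(\<integral>\<^sup>+x. g x \<partial>lborel)
      = (\<integral>\<^sup>+x. g x \<partial>density (distr lborel borel (\<lambda>x. \<chi> i. c i * x $ i)) (\<lambda>_. \<Prod>i\<in>UNIV. \<bar>c i\<bar>))"
    using lb by (rule arg_cong)
  then show ?thesis
    by (simp add: nn_integral_density nn_integral_distr nn_integral_cmult)
qed

lemma nn_integral_lborel_swap:
  fixes g :: "real^'i \<Rightarrow> ennreal"
  assumes [measurable]: "g \<in> borel_measurable borel"
  shows "(\<integral>\<^sup>+x. g (\<chi> i. x $ Transposition.transpose m n i) \<partial>lborel) = (\<integral>\<^sup>+x. g x \<partial>lborel)"
proof -
  let ?h = "\<lambda>x::real^'i. \<chi> i. x $ Transposition.transpose m n i"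
  have [measurable]: "?h \<in> borel_measurable borel"
    by measurable
  have "lborel = distr lborel borel ?h"
  proof (rule lborel_eqI)
    fix l u :: "real^'i"
    assume le: "\<And>b. b \<in> Basis \<Longrightarrow> l \<bullet> b \<le> u \<bullet> b"
    have le': "l $ i \<le> u $ i" for i
      using le[of "axis i 1"] by (simp add: inner_axis axis_in_Basis_iff)
    have "x \<in> box (?h l) (?h u) \<longleftrightarrow> ?h x \<in> box l u" for x
      by (simp add: mem_box_cart) (metis transpose_involutory)
    then have "?h -` box l u = box (?h l) (?h u)"
      by auto
    then have "emeasure (distr lborel borel ?h) (box l u)
        = (\<Prod>i\<in>UNIV. (u - l) $ Transposition.transpose m n i)"
      by (simp add: emeasure_distr emeasure_lborel_box_vec le')
    also have "\<dots> = ennreal (\<Prod>i\<in>UNIV. (u - l) $ i)"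
      using prod.permute[OF permutes_swap_id, where S=UNIV and g="\<lambda>i. (u - l) $ i", of m n]
      by (simp add: comp_def)
    finally show "emeasure (distr lborel borel ?h) (box l u) = (\<Prod>b\<in>Basis. (u - l) \<bullet> b)"
      by (simp add: prod_Basis_vec inner_axis)
  qed simp
  then have "(\<integral>\<^sup>+x. g x \<partial>lborel) = (\<integral>\<^sup>+x. g x \<partial>distr lborel borel ?h)"
    by (rule arg_cong)
  then show ?thesis
    by (simp add: nn_integral_distr)
qed

text \<open>Linear maps are generated by maps that kill a coordinate, stretches, swaps and shears,
  and under composition the factors \<open>\<bar>det\<bar>\<close> multiply.\<close>

lemma nn_integral_lborel_linear:
  fixes f :: "real^'i \<Rightarrow> real^'i"
  assumes "linear f" "det (matrix f) \<noteq> 0" "g \<in> borel_measurable borel"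
  shows "ennreal \<bar>det (matrix f)\<bar> * (\<integral>\<^sup>+x. g (f x) \<partial>lborel) = (\<integral>\<^sup>+x. g x \<partial>lborel)"
proof -
  \<comment> \<open>Nonsingularity sits inside the induction predicate because singular elementary
    maps occur; a nonsingular composite has nonsingular factors, so the composition step goes
    through.\<close>
  let ?P = "\<lambda>f::real^'i \<Rightarrow> real^'i. det (matrix f) \<noteq> 0 \<longrightarrow> (\<forall>g\<in>borel_measurable borel.
      ennreal \<bar>det (matrix f)\<bar> * (\<integral>\<^sup>+x. g (f x) \<partial>lborel) = (\<integral>\<^sup>+x. g x \<partial>lborel))"
  have "?P f"
  proof (rule induct_linear_elementary[OF assms(1)]; intro impI ballI)
    fix f h :: "real^'i \<Rightarrow> real^'i" and g :: "real^'i \<Rightarrow> ennreal"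
    assume lin: "linear f" "linear h" and P: "?P f" "?P h"
      and det: "det (matrix (f \<circ> h)) \<noteq> 0" and g[measurable]: "g \<in> borel_measurable borel"
    have comp: "matrix (f \<circ> h) = matrix f ** matrix h"
      using matrix_compose[OF lin(2,1)] .
    have [measurable]: "f \<in> borel_measurable borel"
      using lin(1) by (intro borel_measurable_continuous_onI linear_continuous_on linear_conv_bounded_linear[THEN iffD1])
    have "ennreal \<bar>det (matrix f)\<bar> * (ennreal \<bar>det (matrix h)\<bar> * (\<integral>\<^sup>+x. g (f (h x)) \<partial>lborel))
        = ennreal \<bar>det (matrix f)\<bar> * (\<integral>\<^sup>+x. g (f x) \<partial>lborel)"
      using P(2) det by (subst P(2)[rule_format, of "\<lambda>x. g (f x)"]) (auto simp: comp det_mul)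
    also have "\<dots> = (\<integral>\<^sup>+x. g x \<partial>lborel)"
      using P(1) det g by (auto simp: comp det_mul)
    finally show "ennreal \<bar>det (matrix (f \<circ> h))\<bar> * (\<integral>\<^sup>+x. g ((f \<circ> h) x) \<partial>lborel) = (\<integral>\<^sup>+x. g x \<partial>lborel)"
      by (simp add: comp det_mul abs_mult ennreal_mult mult.assoc)
  next
    fix f :: "real^'i \<Rightarrow> real^'i" and i and g :: "real^'i \<Rightarrow> ennreal"
    assume "linear f" and 0: "\<And>x. f x $ i = 0" and det: "det (matrix f) \<noteq> 0"
    then have "\<not> inj f"
      by (metis (full_types) linear_injective_imp_surjective one_neq_zero surjE vec_component)
    then show "ennreal \<bar>det (matrix f)\<bar> * (\<integral>\<^sup>+x. g (f x) \<partial>lborel) = (\<integral>\<^sup>+x. g x \<partial>lborel)"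
      using det det_nz_iff_inj[OF \<open>linear f\<close>] by blast
  next
    fix c and g :: "real^'i \<Rightarrow> ennreal"
    assume det: "det (matrix (\<lambda>x::real^'i. \<chi> i. c i * x $ i)) \<noteq> 0" and "g \<in> borel_measurable borel"
    have "det (matrix (\<lambda>x::real^'i. \<chi> i. c i * x $ i)) = (\<Prod>i\<in>UNIV. c i)"
      by (simp add: axis_def matrix_def det_diagonal)
    with det nn_integral_lborel_stretch[OF \<open>g \<in> _\<close>, of c]
    show "ennreal \<bar>det (matrix (\<lambda>x::real^'i. \<chi> i. c i * x $ i))\<bar> *
        (\<integral>\<^sup>+x. g (\<chi> i. c i * x $ i) \<partial>lborel) = (\<integral>\<^sup>+x. g x \<partial>lborel)"
      by (simp add: abs_prod)
  next
    fix m n :: 'i and g :: "real^'i \<Rightarrow> ennreal"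
    assume g: "g \<in> borel_measurable borel"
    let ?h = "\<lambda>v::real^'i. \<chi> i. v $ Transposition.transpose m n i"
    have "(\<chi> i j. if Transposition.transpose m n i = j then 1 else 0) =
        (\<chi> i j. if j = Transposition.transpose m n i then 1 else (0::real))"
      by (auto intro!: Cart_lambda_cong)
    then have "matrix ?h = transpose (\<chi> i j. mat 1 $ i $ Transposition.transpose m n j)"
      by (auto simp: matrix_eq transpose_def axis_def mat_def matrix_def)
    then have "\<bar>det (matrix ?h)\<bar> = 1"
      by (simp add: det_permute_columns permutes_swap_id sign_swap_id abs_mult)
    then show "ennreal \<bar>det (matrix ?h)\<bar> * (\<integral>\<^sup>+x. g (?h x) \<partial>lborel) = (\<integral>\<^sup>+x. g x \<partial>lborel)"
      by (simp add: nn_integral_lborel_swap[OF g])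
  next
    fix m n :: 'i and g :: "real^'i \<Rightarrow> ennreal"
    assume "m \<noteq> n" and g: "g \<in> borel_measurable borel"
    let ?h = "\<lambda>v::real^'i. \<chi> i. if i = m then v $ m + v $ n else v $ i"
    have "matrix ?h = (\<chi> k. if k = m then row m (mat 1) + 1 *s row n (mat 1) else row k (mat 1))"
      by (auto simp: matrix_def axis_def mat_def row_def vec_eq_iff)
    then have "det (matrix ?h) = 1"
      using det_row_operation[OF \<open>m \<noteq> n\<close>, of "mat 1" 1] by simp
    then show "ennreal \<bar>det (matrix ?h)\<bar> * (\<integral>\<^sup>+x. g (?h x) \<partial>lborel) = (\<integral>\<^sup>+x. g x \<partial>lborel)"
      by (simp add: nn_integral_lborel_shear[OF g \<open>m \<noteq> n\<close>])
  qed
  then show ?thesis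
    using assms(2,3) by blast
qed

section \<open>Change of measure along a channel with feedback\<close>

context prob_space
begin

text \<open>The library's \<open>indep_var\<close> requires both variables to have the same value type, so it cannot be
  applied to \<open>V\<close> and the identity map into \<open>N\<close>.\<close>

definition indep_of :: "'a measure \<Rightarrow> ('a \<Rightarrow> 'b::topological_space) \<Rightarrow> bool" where
  "indep_of N V \<longleftrightarrow> (\<lambda>\<omega>. \<omega>) \<in> M \<rightarrow>\<^sub>M N \<and> V \<in> borel_measurable M \<and>
     (\<forall>A\<in>sets N. \<forall>B\<in>sets borel.
        prob (A \<inter> space M \<inter> (V -` B \<inter> space M)) = prob (A \<inter> space M) * prob (V -` B \<inter> space M))"

lemma indep_of_measurable:
  assumes "indep_of N V"
  shows "(\<lambda>\<omega>. \<omega>) \<in> M \<rightarrow>\<^sub>M N" and "V \<in> borel_measurable M"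
  using assms by (auto simp: indep_of_def)

text \<open>The first component is the sample point itself, seen through the coarser algebra
  \<open>N\<close>, so side information never has to be encoded as a random variable. Rectangles
  determine the joint law.\<close>

lemma indep_of_distr:
  assumes "indep_of N V"
  shows "distr M (N \<Otimes>\<^sub>M borel) (\<lambda>\<omega>. (\<omega>, V \<omega>)) = distr M N (\<lambda>\<omega>. \<omega>) \<Otimes>\<^sub>M distr M borel V"
proof -
  note [measurable] = indep_of_measurable[OF assms]
  interpret N: prob_space "distr M N (\<lambda>\<omega>. \<omega>)"
    by (rule prob_space_distr) simp
  interpret V: prob_space "distr M borel V"
    by (rule prob_space_distr) simp
  have "distr M N (\<lambda>\<omega>. \<omega>) \<Otimes>\<^sub>M distr M borel V = distr M (N \<Otimes>\<^sub>M borel) (\<lambda>\<omega>. (\<omega>, V \<omega>))"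
  proof (rule pair_measure_eqI)
    fix A B assume "A \<in> sets (distr M N (\<lambda>\<omega>. \<omega>))" "B \<in> sets (distr M borel V)"
    then have [measurable]: "A \<in> sets N" "B \<in> sets borel"
      by simp_all
    have "(\<lambda>\<omega>. (\<omega>, V \<omega>)) -` (A \<times> B) \<inter> space M = A \<inter> space M \<inter> (V -` B \<inter> space M)"
      by auto
    then have "emeasure (distr M (N \<Otimes>\<^sub>M borel) (\<lambda>\<omega>. (\<omega>, V \<omega>))) (A \<times> B)
        = prob (A \<inter> space M \<inter> (V -` B \<inter> space M))"
      by (simp add: emeasure_distr emeasure_eq_measure)
    also have "\<dots> = prob (A \<inter> space M) * prob (V -` B \<inter> space M)"
      using assms by (simp add: indep_of_def)
    also have "\<dots> = emeasure (distr M N (\<lambda>\<omega>. \<omega>)) A * emeasure (distr M borel V) B"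
      by (simp add: emeasure_distr emeasure_eq_measure ennreal_mult)
    finally show "emeasure (distr M N (\<lambda>\<omega>. \<omega>)) A * emeasure (distr M borel V) B
        = emeasure (distr M (N \<Otimes>\<^sub>M borel) (\<lambda>\<omega>. (\<omega>, V \<omega>))) (A \<times> B)" ..
  qed (simp_all add: N.sigma_finite_measure_axioms V.sigma_finite_measure_axioms cong: sets_pair_measure_cong)
  then show ?thesis ..
qed

text \<open>Passage to the library's notion, for the products of input and noise whose means are
  needed later.\<close>

lemma indep_of_imp_indep_var:
  assumes V: "indep_of N V" and s: "s \<in> N \<rightarrow>\<^sub>M S" and h: "h \<in> borel \<rightarrow>\<^sub>M T"
  shows "indep_var S s T (\<lambda>\<omega>. h (V \<omega>))"
proof -
  note [measurable] = indep_of_measurable[OF V] s h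
  have [measurable]: "s \<in> M \<rightarrow>\<^sub>M S"
    using measurable_compose[OF indep_of_measurable(1)[OF V] s] .
  have sp: "space M \<subseteq> space N"
    using measurable_space[OF indep_of_measurable(1)[OF V]] by auto
  have "indep_sets (case_bool {s -` A \<inter> space M |A. A \<in> sets S}
      {(\<lambda>\<omega>. h (V \<omega>)) -` A \<inter> space M |A. A \<in> sets T}) UNIV"
    unfolding indep_set_def[symmetric] indep_sets2_eq
  proof (intro conjI ballI)
    fix a b
    assume "a \<in> {s -` A \<inter> space M |A. A \<in> sets S}"
      and "b \<in> {(\<lambda>\<omega>. h (V \<omega>)) -` A \<inter> space M |A. A \<in> sets T}"
    then obtain A B where A: "A \<in> sets S" "a = s -` A \<inter> space M"
      and B: "B \<in> sets T" "b = (\<lambda>\<omega>. h (V \<omega>)) -` B \<inter> space M"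
      by auto
    have a: "a = (s -` A \<inter> space N) \<inter> space M" "s -` A \<inter> space N \<in> sets N"
      using A sp s by auto
    have b: "b = V -` (h -` B) \<inter> space M" "h -` B \<in> sets borel"
      using B h measurable_sets[OF h B(1)] by auto
    show "prob (a \<inter> b) = prob a * prob b"
      using V a b unfolding indep_of_def by metis
  qed auto
  moreover have "(\<lambda>i. {case_bool s (\<lambda>\<omega>. h (V \<omega>)) i -` A \<inter> space M |A. A \<in> sets (case_bool S T i)})
      = case_bool {s -` A \<inter> space M |A. A \<in> sets S} {(\<lambda>\<omega>. h (V \<omega>)) -` A \<inter> space M |A. A \<in> sets T}"
    by (auto split: bool.split simp: fun_eq_iff)
  ultimately show ?thesis
    unfolding indep_var_def indep_vars_def2 by (auto split: bool.split)
qed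

text \<open>Conditioning on \<open>N\<close> without conditional distributions: the joint law is a
  product, so Fubini integrates \<open>V\<close> out against its density while the side information
  is held fixed.\<close>

lemma nn_integral_freeze:
  assumes indep: "indep_of N V"
    and V: "distributed M lborel V \<phi>"
    and G [measurable]: "G \<in> borel_measurable (N \<Otimes>\<^sub>M borel)"
  shows "(\<integral>\<^sup>+\<omega>. G (\<omega>, V \<omega>) \<partial>M) = (\<integral>\<^sup>+\<omega>. (\<integral>\<^sup>+z. \<phi> z * G (\<omega>, z) \<partial>lborel) \<partial>M)"
proof -
  note [measurable] = indep_of_measurable[OF indep]
  have [measurable]: "\<phi> \<in> borel_measurable borel"
    using V by (auto simp: distributed_def)
  interpret V: prob_space "distr M borel V"
    by (rule prob_space_distr) simp
  have dV: "distr M borel V = density lborel \<phi>"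
    using V by (auto simp: distributed_def cong: distr_cong)
  have "(\<integral>\<^sup>+\<omega>. G (\<omega>, V \<omega>) \<partial>M) = (\<integral>\<^sup>+x. G x \<partial>distr M (N \<Otimes>\<^sub>M borel) (\<lambda>\<omega>. (\<omega>, V \<omega>)))"
    by (simp add: nn_integral_distr)
  also have "\<dots> = (\<integral>\<^sup>+x. G x \<partial>(distr M N (\<lambda>\<omega>. \<omega>) \<Otimes>\<^sub>M distr M borel V))"
    using indep by (simp add: indep_of_distr)
  also have "\<dots> = (\<integral>\<^sup>+\<omega>. (\<integral>\<^sup>+z. G (\<omega>, z) \<partial>distr M borel V) \<partial>distr M N (\<lambda>\<omega>. \<omega>))"
    by (rule V.nn_integral_fst[symmetric]) simp
  also have "\<dots> = (\<integral>\<^sup>+\<omega>. (\<integral>\<^sup>+z. G (\<omega>, z) \<partial>distr M borel V) \<partial>M)"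
    by (subst nn_integral_distr) (auto intro!: V.borel_measurable_nn_integral)
  also have "\<dots> = (\<integral>\<^sup>+\<omega>. (\<integral>\<^sup>+z. \<phi> z * G (\<omega>, z) \<partial>lborel) \<partial>M)"
  proof (rule nn_integral_cong)
    fix \<omega> assume "\<omega> \<in> space M"
    then have \<omega>: "\<omega> \<in> space N"
      by (rule measurable_space[OF indep_of_measurable(1)[OF indep]])
    have [measurable]: "(\<lambda>z. G (\<omega>, z)) \<in> borel_measurable borel"
      using \<omega> by simp
    show "(\<integral>\<^sup>+z. G (\<omega>, z) \<partial>distr M borel V) = (\<integral>\<^sup>+z. \<phi> z * G (\<omega>, z) \<partial>lborel)"
      unfolding dV by (simp add: nn_integral_density)
  qed
  finally show ?thesis .
qed

text \<open>Under the measure reweighted by the likelihood ratio, the outputs \<open>R k\<close> form an i.i.d. sequence with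
  density \<open>q\<close> that is independent of everything upstream of the channel, so it is enough to bound \<open>F\<close>
  for each frozen output path.\<close>

lemma nn_integral_likelihood_ratio_le:
  fixes R s V :: "nat \<Rightarrow> 'a \<Rightarrow> 'b::euclidean_space" and \<phi> q :: "'b \<Rightarrow> real"
    and F :: "'a \<times> (nat \<Rightarrow> 'b) \<Rightarrow> ennreal"
  assumes indep: "\<And>k. indep_of (N k) (V k)"
    and V: "\<And>k. distributed M lborel (V k) \<phi>"
    and \<phi>: "\<phi> \<in> borel_measurable borel" "\<And>x. 0 < \<phi> x"
    and q: "q \<in> borel_measurable borel" "\<And>x. 0 \<le> q x" "(\<integral>\<^sup>+x. q x \<partial>lborel) \<le> 1"
    and R: "\<And>k \<omega>. \<omega> \<in> space M \<Longrightarrow> R k \<omega> = s k \<omega> + V k \<omega>"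
    and s: "\<And>k. s k \<in> borel_measurable (N k)"
    and past: "\<And>j k. j < k \<Longrightarrow> R j \<in> borel_measurable (N k)"
      "\<And>j k. j < k \<Longrightarrow> V j \<in> borel_measurable (N k)"
    and F: "\<And>k. F \<in> borel_measurable (N k \<Otimes>\<^sub>M PiM UNIV (\<lambda>_. borel))"
      "\<And>r. (\<integral>\<^sup>+\<omega>. F (\<omega>, r) \<partial>M) \<le> C"
  shows "(\<integral>\<^sup>+\<omega>. (\<Prod>k<K. ennreal (q (R k \<omega>) / \<phi> (V k \<omega>))) * F (\<omega>, \<lambda>k. if k < K then R k \<omega> else 0) \<partial>M) \<le> C"
  using F
proof (induction K arbitrary: F)
  case 0
  then show ?case by simp
next
  case (Suc K)
  note [measurable] = \<phi>(1) q(1) s[of K] Suc.prems(1)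
  define F' where "F' = (\<lambda>(\<omega>, r). \<integral>\<^sup>+x. ennreal (q x) * F (\<omega>, r(K := x)) \<partial>lborel)"
  define \<Lambda> where "\<Lambda> \<omega> = (\<Prod>k<K. ennreal (q (R k \<omega>) / \<phi> (V k \<omega>)))" for \<omega>
  \<comment> \<open>Slots from \<open>K\<close> on are padded with 0, so paths of all lengths live
    in one space and one more use is a single update.\<close>
  define r where "r \<omega> = (\<lambda>k. if k < K then R k \<omega> else 0)" for \<omega>
  have id [measurable]: "(\<lambda>\<omega>. \<omega>) \<in> M \<rightarrow>\<^sub>M N k" for k
    using indep by (rule indep_of_measurable)
  have upd: "(\<lambda>x. (f x)(K := g x)) \<in> L \<rightarrow>\<^sub>M PiM UNIV (\<lambda>_. borel)"
    if "f \<in> L \<rightarrow>\<^sub>M PiM UNIV (\<lambda>_. borel)" "g \<in> borel_measurable L"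
    for f :: "'z \<Rightarrow> nat \<Rightarrow> 'b" and g L
    using that unfolding fun_upd_def by (intro measurable_abs_UNIV) (auto simp: measurable_PiM_component_rev intro!: measurable_If measurable_compose[OF _ measurable_component_singleton])
  have r_meas [measurable]: "r \<in> N K \<rightarrow>\<^sub>M PiM UNIV (\<lambda>_. borel)"
    unfolding r_def
  proof (rule measurable_abs_UNIV)
    show "(\<lambda>\<omega>. if k < K then R k \<omega> else 0) \<in> borel_measurable (N K)" for k
      using past(1)[of k K] by (cases "k < K") auto
  qed
  have \<Lambda>_meas [measurable]: "\<Lambda> \<in> borel_measurable (N K)"
    unfolding \<Lambda>_def
  proof (rule borel_measurable_prod_ennreal)
    fix k assume "k \<in> {..<K}"
    then have [measurable]: "R k \<in> borel_measurable (N K)" "V k \<in> borel_measurable (N K)"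
      by (auto intro: past)
    show "(\<lambda>\<omega>. ennreal (q (R k \<omega>) / \<phi> (V k \<omega>))) \<in> borel_measurable (N K)"
      by measurable
  qed
  have F'_meas: "F' \<in> borel_measurable (N k \<Otimes>\<^sub>M PiM UNIV (\<lambda>_. borel))" for k
  proof -
    have [measurable]: "(\<lambda>z. (snd (fst z))(K := snd z)) \<in>
        (N k \<Otimes>\<^sub>M PiM UNIV (\<lambda>_. borel)) \<Otimes>\<^sub>M borel \<rightarrow>\<^sub>M PiM UNIV (\<lambda>_. borel :: 'b measure)"
      by (rule upd) measurable
    have "(\<lambda>(y, x). ennreal (q x) * F (fst y, (snd y)(K := x)))
        \<in> borel_measurable ((N k \<Otimes>\<^sub>M PiM UNIV (\<lambda>_. borel)) \<Otimes>\<^sub>M lborel)"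
      unfolding split_beta by measurable
    from lborel.borel_measurable_nn_integral_fst[OF this]
    show ?thesis
      by (simp add: F'_def split_beta)
  qed
  have F'_le: "(\<integral>\<^sup>+\<omega>. F' (\<omega>, r) \<partial>M) \<le> C" for r
  proof -
    interpret pair_sigma_finite M "lborel :: 'b measure" ..
    have [measurable]: "(\<lambda>z. r(K := snd z)) \<in> M \<Otimes>\<^sub>M borel \<rightarrow>\<^sub>M PiM UNIV (\<lambda>_. borel :: 'b measure)"
      by (rule upd) (auto simp: space_PiM)
    have [measurable]: "(\<lambda>x. F (fst x, r(K := snd x))) \<in> borel_measurable (M \<Otimes>\<^sub>M borel)"
      using Suc.prems(1)[of 0] by measurable
    have "(\<integral>\<^sup>+\<omega>. F' (\<omega>, r) \<partial>M) = (\<integral>\<^sup>+x. (\<integral>\<^sup>+\<omega>. ennreal (q x) * F (\<omega>, r(K := x)) \<partial>M) \<partial>lborel)"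
      unfolding F'_def by (simp, subst Fubini') (auto simp: split_beta)
    also have "\<dots> = (\<integral>\<^sup>+x. ennreal (q x) * (\<integral>\<^sup>+\<omega>. F (\<omega>, r(K := x)) \<partial>M) \<partial>lborel)"
    proof (intro nn_integral_cong nn_integral_cmult)
      fix x
      show "(\<lambda>\<omega>. F (\<omega>, r(K := x))) \<in> borel_measurable M"
        using Suc.prems(1)[of 0] by (rule measurable_compose[rotated]) (auto simp: space_PiM)
    qed
    also have "\<dots> \<le> (\<integral>\<^sup>+x. ennreal (q x) * C \<partial>lborel)"
      by (intro nn_integral_mono mult_left_mono Suc.prems(2)) simp
    also have "\<dots> = (\<integral>\<^sup>+x. ennreal (q x) \<partial>lborel) * C"
      by (simp add: nn_integral_multc)
    also have "\<dots> \<le> 1 * C"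
      using q(3) by (rule mult_right_mono) simp
    finally show ?thesis by simp
  qed
  \<comment> \<open>Everything except the noise of the last use is \<open>N K\<close>-measurable;
    \<open>G\<close> isolates that noise as its second argument.\<close>
  define G where "G = (\<lambda>(\<omega>, z). \<Lambda> \<omega> * ennreal (q (s K \<omega> + z) / \<phi> z) * F (\<omega>, (r \<omega>)(K := s K \<omega> + z)))"
  have [measurable]: "(\<lambda>x. (r (fst x))(K := s K (fst x) + snd x)) \<in> N K \<Otimes>\<^sub>M borel \<rightarrow>\<^sub>M PiM UNIV (\<lambda>_. borel)"
    by (rule upd) measurable
  have G_meas: "G \<in> borel_measurable (N K \<Otimes>\<^sub>M borel)"
    unfolding G_def split_beta by measurable
  have "(\<integral>\<^sup>+\<omega>. (\<Prod>k<Suc K. ennreal (q (R k \<omega>) / \<phi> (V k \<omega>))) * F (\<omega>, \<lambda>k. if k < Suc K then R k \<omega> else 0) \<partial>M)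
      = (\<integral>\<^sup>+\<omega>. G (\<omega>, V K \<omega>) \<partial>M)"
  proof (rule nn_integral_cong)
    fix \<omega> assume "\<omega> \<in> space M"
    then have "(\<lambda>k. if k < Suc K then R k \<omega> else 0) = (r \<omega>)(K := s K \<omega> + V K \<omega>)"
      by (auto simp: r_def fun_eq_iff less_Suc_eq R)
    then show "(\<Prod>k<Suc K. ennreal (q (R k \<omega>) / \<phi> (V k \<omega>))) * F (\<omega>, \<lambda>k. if k < Suc K then R k \<omega> else 0)
        = G (\<omega>, V K \<omega>)"
      using \<open>\<omega> \<in> space M\<close> by (simp add: G_def \<Lambda>_def R)
  qed
  also have "\<dots> = (\<integral>\<^sup>+\<omega>. (\<integral>\<^sup>+z. ennreal (\<phi> z) * G (\<omega>, z) \<partial>lborel) \<partial>M)"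
    by (rule nn_integral_freeze[OF indep V G_meas])
  also have "\<dots> = (\<integral>\<^sup>+\<omega>. \<Lambda> \<omega> * F' (\<omega>, r \<omega>) \<partial>M)"
  proof (rule nn_integral_cong)
    fix \<omega> assume "\<omega> \<in> space M"
    then have [simp]: "\<omega> \<in> space (N K)"
      by (rule measurable_space[OF id])
    have F_upd [measurable]: "(\<lambda>x. F (\<omega>, (r \<omega>)(K := g x))) \<in> borel_measurable borel"
      if "g \<in> borel_measurable borel" for g :: "'b \<Rightarrow> 'b"
    proof (rule measurable_compose[OF _ Suc.prems(1)[of K]])
      have "(\<lambda>x. (r \<omega>)(K := g x)) \<in> borel \<rightarrow>\<^sub>M PiM UNIV (\<lambda>_. borel :: 'b measure)"
        using that by (intro upd) (auto simp: space_PiM)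
      then show "(\<lambda>x. (\<omega>, (r \<omega>)(K := g x))) \<in> borel \<rightarrow>\<^sub>M N K \<Otimes>\<^sub>M PiM UNIV (\<lambda>_. borel)"
        by (intro measurable_Pair) simp_all
    qed
    have "(\<integral>\<^sup>+z. ennreal (\<phi> z) * G (\<omega>, z) \<partial>lborel)
        = (\<integral>\<^sup>+z. \<Lambda> \<omega> * (ennreal (q (s K \<omega> + z)) * F (\<omega>, (r \<omega>)(K := s K \<omega> + z))) \<partial>lborel)"
    proof (rule nn_integral_cong)
      fix z
      \<comment> \<open>The noise density cancels the denominator of the ratio.\<close>
      have "ennreal (\<phi> z) * ennreal (q (s K \<omega> + z) / \<phi> z) = ennreal (q (s K \<omega> + z))"
        using \<phi>(2)[of z] q(2) by (simp add: ennreal_mult[symmetric])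
      then show "ennreal (\<phi> z) * G (\<omega>, z) = \<Lambda> \<omega> * (ennreal (q (s K \<omega> + z)) * F (\<omega>, (r \<omega>)(K := s K \<omega> + z)))"
        unfolding G_def split_conv by (metis mult.assoc mult.left_commute)
    qed
    also have "\<dots> = \<Lambda> \<omega> * (\<integral>\<^sup>+z. ennreal (q (s K \<omega> + z)) * F (\<omega>, (r \<omega>)(K := s K \<omega> + z)) \<partial>lborel)"
      by (rule nn_integral_cmult) measurable
    also have "\<dots> = \<Lambda> \<omega> * F' (\<omega>, r \<omega>)"
      \<comment> \<open>Translation invariance absorbs the channel input
        \<open>s K \<omega>\<close>; here the dependence on the past through feedback
        disappears.\<close>
      unfolding F'_def split_conv
      by (subst nn_integral_translate[of "\<lambda>x. ennreal (q x) * F (\<omega>, (r \<omega>)(K := x))"]) auto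
    finally show "(\<integral>\<^sup>+z. ennreal (\<phi> z) * G (\<omega>, z) \<partial>lborel) = \<Lambda> \<omega> * F' (\<omega>, r \<omega>)" .
  qed
  also have "\<dots> \<le> C"
    using Suc.IH[OF F'_meas F'_le] unfolding \<Lambda>_def r_def .
  finally show ?case .
qed

end

section \<open>The information rate bound\<close>

lemma nn_integral_normal_density:
  assumes "0 < \<sigma>"
  shows "(\<integral>\<^sup>+x. normal_density \<mu> \<sigma> x \<partial>lborel) = 1"
  using assms by (subst nn_integral_eq_integral) auto

lemma nn_integral_exp_norm:
  "(\<integral>\<^sup>+(x::real^'n). ennreal (exp (- (norm x)\<^sup>2 / 2)) \<partial>lborel) = ennreal (sqrt (2 * pi) ^ CARD('n))"
proof -
  have eq: "exp (- (norm x)\<^sup>2 / 2) = (\<Prod>i\<in>UNIV. sqrt (2 * pi) * std_normal_density (x $ i))" for x :: "real^'n"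
    by (simp add: std_normal_density_def power2_norm_eq_inner inner_vec_def exp_sum sum_negf
        flip: sum_divide_distrib power2_eq_square exp_sum)
  have "(\<integral>\<^sup>+(x::real^'n). ennreal (exp (- (norm x)\<^sup>2 / 2)) \<partial>lborel)
      = (\<Prod>i\<in>(UNIV :: 'n set). \<integral>\<^sup>+x. ennreal (sqrt (2 * pi) * std_normal_density x) \<partial>lborel)"
    unfolding eq by (rule nn_integral_prod_vec) auto
  also have "\<dots> = ennreal (sqrt (2 * pi) ^ CARD('n))"
    by (simp add: ennreal_mult nn_integral_cmult nn_integral_normal_density ennreal_power)
  finally show ?thesis .
qed

text \<open>This brings the determinant into the bound: the map takes the initial state to the state
  at time \<open>t\<close>, with the effect of noise and control collected in the shift
  \<open>c\<close>.\<close>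

lemma nn_integral_lborel_affine_iterate:
  fixes A :: "real^'n^'n"
  assumes "det A \<noteq> 0" and [measurable]: "g \<in> borel_measurable borel"
  shows "ennreal (\<bar>det A\<bar> ^ t) * (\<integral>\<^sup>+x. g (((*v) A ^^ t) x + c) \<partial>lborel) = (\<integral>\<^sup>+x. g x \<partial>lborel)"
proof -
  have lin: "linear ((*v) A ^^ t)" for t
  proof (induction t)
    case (Suc t)
    from linear_compose[OF this matrix_vector_mul_linear[of A]] show ?case by (simp add: comp_def)
  qed (simp add: linear_iff)
  have det: "det (matrix ((*v) A ^^ t)) = det A ^ t" for t
  proof (induction t)
    case (Suc t)
    have "matrix ((*v) A ^^ Suc t) = A ** matrix ((*v) A ^^ t)"
      using matrix_compose[OF lin[of t] matrix_vector_mul_linear[of A]] by (simp add: comp_def)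
    then show ?case
      by (simp only: det_mul Suc power_Suc)
  qed (simp add: id_def matrix_id[unfolded id_def] flip: mat_def)
  have "ennreal \<bar>det (matrix ((*v) A ^^ t))\<bar> * (\<integral>\<^sup>+x. g (c + ((*v) A ^^ t) x) \<partial>lborel) = (\<integral>\<^sup>+x. g (c + x) \<partial>lborel)"
    using assms(1) by (intro nn_integral_lborel_linear[OF lin, where g="\<lambda>x. g (c + x)"]) (auto simp: det)
  then show ?thesis
    using nn_integral_translate[OF assms(2), of c] by (simp add: det power_abs add.commute)
qed

text \<open>The Gaussian centred at the controller's estimate of the initial state, which has error
  \<open>A\<^sup>-\<^sup>2\<^sup>K X K\<close>, is the reference density for the initial state given the channel outputs.\<close>

lemma (in prob_space) log_det_le_information_rate:
  fixes A :: "real^'n^'n" and \<xi> :: "'a \<Rightarrow> real^'n"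
    and R s V :: "nat \<Rightarrow> 'a \<Rightarrow> 'b::euclidean_space" and \<phi> q :: "'b \<Rightarrow> real"
    and X :: "nat \<Rightarrow> 'a \<Rightarrow> real^'n" and c :: "nat \<Rightarrow> 'a \<times> (nat \<Rightarrow> 'b) \<Rightarrow> real^'n"
  assumes indep: "\<And>k. indep_of (N k) (V k)"
    and V: "\<And>k. distributed M lborel (V k) \<phi>"
    and \<phi>: "\<phi> \<in> borel_measurable borel" "\<And>x. 0 < \<phi> x"
    and q: "q \<in> borel_measurable borel" "\<And>x. 0 < q x" "(\<integral>\<^sup>+x. q x \<partial>lborel) \<le> 1"
    and R: "\<And>k \<omega>. \<omega> \<in> space M \<Longrightarrow> R k \<omega> = s k \<omega> + V k \<omega>"
    and s: "\<And>k. s k \<in> borel_measurable (N k)"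
    and past: "\<And>j k. j < k \<Longrightarrow> R j \<in> borel_measurable (N k)"
      "\<And>j k. j < k \<Longrightarrow> V j \<in> borel_measurable (N k)"
    and rate: "\<And>k. integrable M (\<lambda>\<omega>. ln (q (R k \<omega>) / \<phi> (V k \<omega>)))"
      "\<And>k. expectation (\<lambda>\<omega>. ln (q (R k \<omega>) / \<phi> (V k \<omega>))) = - I"
    and init: "distributed M lborel \<xi> p" "p \<in> borel_measurable borel" "\<And>x. 0 \<le> p x"
      "integrable lborel (\<lambda>x. p x * ln (p x))"
    and NO: "indep_of NO \<xi>" "\<And>k. (\<lambda>\<omega>. \<omega>) \<in> N k \<rightarrow>\<^sub>M NO" "\<And>k. \<xi> \<in> borel_measurable (N k)"
    and c: "\<And>K. c K \<in> borel_measurable (NO \<Otimes>\<^sub>M PiM UNIV (\<lambda>_. borel))"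
    and X: "\<And>K \<omega>. \<omega> \<in> space M \<Longrightarrow>
        X K \<omega> = ((*v) A ^^ (2 * K)) (\<xi> \<omega>) + c K (\<omega>, \<lambda>k. if k < K then R k \<omega> else 0)"
    and X_meas: "\<And>K. X K \<in> borel_measurable M"
    and stable: "\<And>K. (\<integral>\<^sup>+\<omega>. ennreal ((norm (X K \<omega>))\<^sup>2) \<partial>M) < ennreal m"
    and det: "det A \<noteq> 0"
  shows "2 * ln \<bar>det A\<bar> \<le> I"
proof -
  note [measurable] = \<phi>(1) q(1) init(2) X_meas c
  have [measurable]: "\<xi> \<in> borel_measurable M"
    using NO(1) by (rule indep_of_measurable)
  have [measurable]: "(\<lambda>\<omega>. \<omega>) \<in> M \<rightarrow>\<^sub>M N k" for k
    using indep by (rule indep_of_measurable)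
  have V_meas [measurable]: "V k \<in> borel_measurable M" for k
    using indep by (rule indep_of_measurable)
  have R_meas [measurable]: "R k \<in> borel_measurable M" for k
  proof -
    have "(\<lambda>\<omega>. s k \<omega> + V k \<omega>) \<in> borel_measurable M"
      using measurable_compose[OF indep_of_measurable(1)[OF indep] s] V_meas by auto
    then show ?thesis
      by (subst measurable_cong[OF R]) auto
  qed
  have lin: "(\<lambda>x. ((*v) A ^^ t) x) \<in> borel_measurable borel" for t
  proof (induction t)
    case (Suc t)
    have "(\<lambda>x. A *v x) \<in> borel_measurable borel"
      by (intro borel_measurable_continuous_onI matrix_vector_mult_linear_continuous_on)
    from measurable_compose[OF Suc this] show ?case by simp
  qed simp
  note [measurable] = lin
  \<comment> \<open>Total mass of \<open>gs\<close>, which is left unnormalised so that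
    \<open>ln (gs x)\<close> is just \<open>- (norm x)\<^sup>2 / 2\<close>.\<close>
  define C0 where "C0 = sqrt (2 * pi) ^ CARD('n)"
  have C0: "C0 > 0"
    by (simp add: C0_def)
  define gs where "gs x = exp (- (norm x)\<^sup>2 / 2)" for x :: "real^'n"
  have [measurable]: "gs \<in> borel_measurable borel"
    unfolding gs_def by measurable
  \<comment> \<open>Everything that does not grow with \<open>K\<close>; the last summand is minus
    the entropy of the initial state, in nats.\<close>
  define D where "D = ln C0 + m / 2 + expectation (\<lambda>\<omega>. ln (p (\<xi> \<omega>)))"
  have p_pos: "AE \<omega> in M. 0 < p (\<xi> \<omega>)"
    using init by (subst distributed_AE2[OF init(1)]) auto
  have p_int: "integrable M (\<lambda>\<omega>. ln (p (\<xi> \<omega>)))"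
    using init by (subst distributed_integrable[OF init(1), symmetric]) auto
  have bound: "real K * (2 * ln \<bar>det A\<bar> - I) \<le> D" for K
  proof -
    define r where "r \<omega> = (\<lambda>k. if k < K then R k \<omega> else 0)" for \<omega>
    \<comment> \<open>The initial-state part of the likelihood ratio, with the output path as a free
      argument. As a function of the initial state its numerator has Lebesgue integral
      \<open>C0\<close>, whatever the path and the shift are.\<close>
    define F where "F = (\<lambda>(\<omega>, r). ennreal (\<bar>det A\<bar> ^ (2 * K) *
        gs (((*v) A ^^ (2 * K)) (\<xi> \<omega>) + c K (\<omega>, r)) / p (\<xi> \<omega>)))"
    define L where "L \<omega> = (\<Prod>k<K. q (R k \<omega>) / \<phi> (V k \<omega>)) *
        (\<bar>det A\<bar> ^ (2 * K) * gs (X K \<omega>) / p (\<xi> \<omega>))" for \<omega>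
    have [measurable]: "L \<in> borel_measurable M"
      unfolding L_def by measurable
    have L_nn: "0 \<le> L \<omega>" for \<omega>
      unfolding L_def using \<phi>(2) q(2) init(3)
      by (intro mult_nonneg_nonneg prod_nonneg divide_nonneg_nonneg ballI) (auto simp: gs_def less_imp_le)
    have F_meas: "F \<in> borel_measurable (N k \<Otimes>\<^sub>M PiM UNIV (\<lambda>_. borel))" for k
    proof -
      have [measurable]: "(\<lambda>x. c K (fst x, snd x)) \<in> borel_measurable (N k \<Otimes>\<^sub>M PiM UNIV (\<lambda>_. borel))"
        by (rule measurable_compose[OF measurable_Pair c])
          (auto intro!: measurable_compose[OF measurable_fst NO(2)])
      have [measurable]: "(\<lambda>x. \<xi> (fst x)) \<in> borel_measurable (N k \<Otimes>\<^sub>M PiM UNIV (\<lambda>_. borel :: 'b measure))"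
        by (rule measurable_compose[OF measurable_fst NO(3)])
      show ?thesis
        unfolding F_def split_beta by measurable
    qed
    have F_le: "(\<integral>\<^sup>+\<omega>. F (\<omega>, r) \<partial>M) \<le> ennreal C0" for r
    proof -
      define G where "G = (\<lambda>(\<omega>, x). ennreal (\<bar>det A\<bar> ^ (2 * K) * gs (((*v) A ^^ (2 * K)) x + c K (\<omega>, r)) / p x))"
      have cr [measurable]: "(\<lambda>x. c K (x, r)) \<in> borel_measurable NO"
        by (rule measurable_compose[OF measurable_Pair c]) (auto simp: space_PiM)
      have G: "G \<in> borel_measurable (NO \<Otimes>\<^sub>M borel)"
        unfolding G_def split_beta by measurable
      have "(\<integral>\<^sup>+\<omega>. F (\<omega>, r) \<partial>M) = (\<integral>\<^sup>+\<omega>. G (\<omega>, \<xi> \<omega>) \<partial>M)"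
        by (simp add: F_def G_def)
      also have "\<dots> = (\<integral>\<^sup>+\<omega>. (\<integral>\<^sup>+x. ennreal (p x) * G (\<omega>, x) \<partial>lborel) \<partial>M)"
        by (rule nn_integral_freeze[OF NO(1) init(1) G])
      also have "\<dots> \<le> (\<integral>\<^sup>+\<omega>. ennreal C0 \<partial>M)"
      proof (rule nn_integral_mono)
        fix \<omega>
        \<comment> \<open>Only an inequality, since \<open>p\<close> may vanish where the Gaussian
          does not.\<close>
        have "(\<integral>\<^sup>+x. ennreal (p x) * G (\<omega>, x) \<partial>lborel)
            \<le> (\<integral>\<^sup>+x. ennreal (\<bar>det A\<bar> ^ (2 * K)) * ennreal (gs (((*v) A ^^ (2 * K)) x + c K (\<omega>, r))) \<partial>lborel)"
        proof (rule nn_integral_mono)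
          fix x
          show "ennreal (p x) * G (\<omega>, x)
              \<le> ennreal (\<bar>det A\<bar> ^ (2 * K)) * ennreal (gs (((*v) A ^^ (2 * K)) x + c K (\<omega>, r)))"
            using init(3)[of x]
            by (cases "p x = 0") (auto simp: G_def gs_def ennreal_mult[symmetric] less_imp_le)
        qed
        also have "\<dots> = (\<integral>\<^sup>+x. ennreal (gs x) \<partial>lborel)"
          using nn_integral_lborel_affine_iterate[OF det, of "\<lambda>x. ennreal (gs x)" "2 * K" "c K (\<omega>, r)"]
          by (simp add: nn_integral_cmult)
        also have "\<dots> = ennreal C0"
          using nn_integral_exp_norm by (simp add: gs_def C0_def)
        finally show "(\<integral>\<^sup>+x. ennreal (p x) * G (\<omega>, x) \<partial>lborel) \<le> ennreal C0" .
      qed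
      finally show ?thesis
        by (simp add: emeasure_space_1)
    qed
    have "(\<integral>\<^sup>+\<omega>. ennreal (L \<omega>) \<partial>M)
        = (\<integral>\<^sup>+\<omega>. (\<Prod>k<K. ennreal (q (R k \<omega>) / \<phi> (V k \<omega>))) * F (\<omega>, \<lambda>k. if k < K then R k \<omega> else 0) \<partial>M)"
    proof (rule nn_integral_cong)
      fix \<omega> assume \<omega>: "\<omega> \<in> space M"
      have "(\<Prod>k<K. ennreal (q (R k \<omega>) / \<phi> (V k \<omega>))) = ennreal (\<Prod>k<K. q (R k \<omega>) / \<phi> (V k \<omega>))"
        using \<phi>(2) q(2) by (intro prod_ennreal) (auto simp: less_imp_le)
      moreover have "0 \<le> (\<Prod>k<K. q (R k \<omega>) / \<phi> (V k \<omega>))"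
        using \<phi>(2) q(2) by (intro prod_nonneg) (auto simp: less_imp_le)
      ultimately show "ennreal (L \<omega>) = (\<Prod>k<K. ennreal (q (R k \<omega>) / \<phi> (V k \<omega>))) *
          F (\<omega>, \<lambda>k. if k < K then R k \<omega> else 0)"
        using init(3) unfolding L_def F_def X[OF \<omega>] split_conv by (subst ennreal_mult) (auto simp: gs_def)
    qed
    also have "\<dots> \<le> ennreal C0"
      using q by (intro nn_integral_likelihood_ratio_le[OF indep V \<phi> q(1) _ q(3) R s past F_meas F_le])
        (auto simp: less_imp_le)
    finally have nnL: "(\<integral>\<^sup>+\<omega>. ennreal (L \<omega>) \<partial>M) \<le> ennreal C0" .
    have L_int: "integrable M L"
      using nnL L_nn by (intro integrableI_nonneg) (auto simp: less_top[symmetric] top_unique)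
    have EL: "expectation L \<le> C0"
      using nnL L_nn C0 by (subst (asm) nn_integral_eq_integral[OF L_int]) (auto simp: ennreal_le_iff)
    have X_fin: "integrable M (\<lambda>\<omega>. (norm (X K \<omega>))\<^sup>2)"
      using stable[of K] by (intro integrableI_nonneg) (auto simp: less_top[symmetric])
    have EX: "expectation (\<lambda>\<omega>. (norm (X K \<omega>))\<^sup>2) \<le> m"
    proof -
      have "ennreal (expectation (\<lambda>\<omega>. (norm (X K \<omega>))\<^sup>2)) < ennreal m"
        using stable[of K] by (subst (asm) nn_integral_eq_integral[OF X_fin]) auto
      then show ?thesis
        by (simp add: ennreal_less_iff)
    qed
    let ?l = "\<lambda>\<omega>. (\<Sum>k<K. ln (q (R k \<omega>) / \<phi> (V k \<omega>))) + real (2 * K) * ln \<bar>det A\<bar>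
        - (norm (X K \<omega>))\<^sup>2 / 2 - ln (p (\<xi> \<omega>))"
    have l_int: "integrable M ?l"
      using rate(1) p_int X_fin by auto
    \<comment> \<open>As \<open>gs\<close> is unnormalised, \<open>L\<close> has mean at most
      \<open>C0\<close> rather than 1; hence the tangent to the logarithm is taken at
      \<open>C0\<close>.\<close>
    have "expectation ?l \<le> expectation (\<lambda>\<omega>. ln C0 + L \<omega> / C0 - 1)"
    proof (rule integral_mono_AE)
      \<comment> \<open>Where \<open>p\<close> vanishes the logarithm of \<open>L\<close> does not
        split into the summands of \<open>?l\<close>, but the initial state avoids that set almost
        surely.\<close>
      show "AE \<omega> in M. ?l \<omega> \<le> ln C0 + L \<omega> / C0 - 1"
        using p_pos
      proof eventually_elim
        case (elim \<omega>)
        have pr: "0 < (\<Prod>k<K. q (R k \<omega>) / \<phi> (V k \<omega>))"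
          using \<phi>(2) q(2) by (intro prod_pos) auto
        have L_pos: "0 < L \<omega>"
          using elim pr det by (auto simp: L_def gs_def)
        have "ln (L \<omega>) = ?l \<omega>"
        proof -
          have "ln (\<Prod>k<K. q (R k \<omega>) / \<phi> (V k \<omega>)) = (\<Sum>k<K. ln (q (R k \<omega>) / \<phi> (V k \<omega>)))"
            by (intro ln_prod) (simp_all add: \<phi>(2)[THEN less_imp_neq, THEN not_sym] q(2)[THEN less_imp_neq, THEN not_sym])
          moreover have "ln (L \<omega>) = ln (\<Prod>k<K. q (R k \<omega>) / \<phi> (V k \<omega>)) + (real (2 * K) * ln \<bar>det A\<bar> + ln (gs (X K \<omega>)) - ln (p (\<xi> \<omega>)))"
            unfolding L_def using pr elim det
            by (subst ln_mult_pos) (simp_all add: ln_mult_pos ln_div ln_realpow gs_def)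
          ultimately show ?thesis
            by (simp add: gs_def)
        qed
        moreover have "ln (L \<omega> / C0) \<le> L \<omega> / C0 - 1"
          using L_pos C0 by (intro ln_le_minus_one) simp
        ultimately show ?case
          using L_pos C0 by (simp add: ln_div)
      qed
    qed (use l_int L_int in auto)
    also have "\<dots> = ln C0 + expectation L / C0 - 1"
      using L_int by (simp add: prob_space)
    also have "\<dots> \<le> ln C0"
      using EL C0 by (simp add: field_simps)
    finally have "expectation ?l \<le> ln C0" .
    moreover have "expectation ?l = - real K * I + real (2 * K) * ln \<bar>det A\<bar>
        - expectation (\<lambda>\<omega>. (norm (X K \<omega>))\<^sup>2) / 2 - expectation (\<lambda>\<omega>. ln (p (\<xi> \<omega>)))"
      using rate p_int X_fin by (simp add: Bochner_Integration.integral_sum prob_space)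
    ultimately show ?thesis
      using EX by (simp add: D_def algebra_simps)
  qed
  show ?thesis
  \<comment> \<open>The left side of \<open>bound\<close> is linear in \<open>K\<close>, its right
    side is constant.\<close>
  proof (rule ccontr)
    assume "\<not> ?thesis"
    then have "0 < 2 * ln \<bar>det A\<bar> - I" by simp
    from reals_Archimedean3[OF this] obtain K where "D < real K * (2 * ln \<bar>det A\<bar> - I)"
      by blast
    with bound[of K] show False by simp
  qed
qed

section \<open>Gaussian channels\<close>

lemma normal_density_sqrt:
  "0 < v \<Longrightarrow> normal_density 0 (sqrt v) x = exp (- x\<^sup>2 / (2 * v)) / sqrt (2 * pi * v)"
  by (simp add: normal_density_def)

text \<open>The centred Gaussian density with covariance \<open>a 1 1\<^sup>T + diag N\<close>, its inverse written out by the
  Sherman-Morrison formula.\<close>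

definition simo_density :: "('l::finite \<Rightarrow> real) \<Rightarrow> real \<Rightarrow> real^'l \<Rightarrow> real" where
  "simo_density N a y = exp (a / (1 + a * (\<Sum>i\<in>UNIV. 1 / N i)) / 2 * (\<Sum>i\<in>UNIV. y $ i / N i)\<^sup>2) /
     sqrt (1 + a * (\<Sum>i\<in>UNIV. 1 / N i)) * (\<Prod>i\<in>UNIV. normal_density 0 (sqrt (N i)) (y $ i))"

context prob_space
begin

text \<open>By the pi-lambda argument, independence passes from intersection-stable families to the
  sigma-algebras that disjoint groups of them generate.\<close>

lemma indep_of_sigma:
  fixes V :: "'a \<Rightarrow> 'b::topological_space"
  assumes E: "indep_sets E UNIV" "\<And>s. Int_stable (E s)" and "I \<inter> J = {}"
    and V: "V \<in> borel_measurable (sigma (space M) (\<Union>s\<in>J. E s))"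
  shows "indep_of (sigma (space M) (\<Union>s\<in>I. E s)) V"
proof -
  have ev: "E s \<subseteq> events" for s
    using E(1) by (auto simp: indep_sets_def)
  have sub: "sigma_sets (space M) (\<Union>s\<in>I. E s) \<subseteq> events" for I
    using ev by (intro sets.sigma_sets_subset) auto
  have Pow: "(\<Union>s\<in>I. E s) \<subseteq> Pow (space M)" for I
    using ev sets.space_closed[of M] by blast
  have "indep_sets (\<lambda>b. sigma_sets (space M) (\<Union>s\<in>(if b then I else J). E s)) UNIV"
    using E \<open>I \<inter> J = {}\<close>
    by (intro indep_sets_collect_sigma) (auto simp: disjoint_family_on_def elim: indep_sets_mono_index[rotated])
  then have "indep_sets (case_bool (sigma_sets (space M) (\<Union>s\<in>I. E s))
      (sigma_sets (space M) (\<Union>s\<in>J. E s))) UNIV"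
    by (rule indep_sets_cong[THEN iffD1, rotated -1]) (auto split: bool.split)
  then have ind: "prob (a \<inter> b) = prob a * prob b"
    if "a \<in> sigma_sets (space M) (\<Union>s\<in>I. E s)" "b \<in> sigma_sets (space M) (\<Union>s\<in>J. E s)" for a b
    using that by (auto simp flip: indep_set_def simp: indep_sets2_eq)
  show ?thesis
    unfolding indep_of_def
  proof (intro conjI ballI)
    show "(\<lambda>\<omega>. \<omega>) \<in> M \<rightarrow>\<^sub>M sigma (space M) (\<Union>s\<in>I. E s)"
      using Pow by (intro measurable_measure_of) (auto intro: sets.Int subsetD[OF ev])
    have "(\<lambda>\<omega>. \<omega>) \<in> M \<rightarrow>\<^sub>M sigma (space M) (\<Union>s\<in>J. E s)"
      using Pow by (intro measurable_measure_of) (auto intro: sets.Int subsetD[OF ev])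
    from measurable_compose[OF this V] show "V \<in> borel_measurable M"
      by simp
    fix A B assume A: "A \<in> sets (sigma (space M) (\<Union>s\<in>I. E s))" and B: "B \<in> sets (borel :: 'b measure)"
    have "A \<in> sigma_sets (space M) (\<Union>s\<in>I. E s)"
      using A Pow by (simp add: sets_measure_of)
    moreover have "V -` B \<inter> space M \<in> sigma_sets (space M) (\<Union>s\<in>J. E s)"
      using measurable_sets[OF V B] Pow by (simp add: sets_measure_of space_measure_of)
    moreover have "A \<inter> space M = A"
      using sets.sets_into_space[OF A] Pow by (simp add: space_measure_of Int_absorb2)
    ultimately show "prob (A \<inter> space M \<inter> (V -` B \<inter> space M)) = prob (A \<inter> space M) * prob (V -` B \<inter> space M)"
      by (simp add: ind)
  qed
qed

text \<open>Serves to pick the noises of one time instant out of the joint family of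
  sources.\<close>

lemma indep_sets_reindex:
  assumes "indep_sets E UNIV" "inj f"
  shows "indep_sets (\<lambda>i. E (f i)) UNIV"
proof (rule indep_setsI)
  show "E (f i) \<subseteq> events" for i
    using assms(1) by (auto simp: indep_sets_def)
  fix A J assume J: "J \<noteq> {}" "finite J" "\<forall>j\<in>J. A j \<in> E (f j)"
  let ?A = "\<lambda>s. A (the_inv f s)"
  have inj: "inj_on f J"
    using assms(2) by (rule inj_on_subset) simp
  have "prob (\<Inter>s\<in>f ` J. ?A s) = (\<Prod>s\<in>f ` J. prob (?A s))"
    using J assms by (intro indep_setsD[OF assms(1)]) (auto simp: the_inv_f_f)
  then show "prob (\<Inter>j\<in>J. A j) = (\<Prod>j\<in>J. prob (A j))"
    using assms(2) by (simp add: prod.reindex[OF inj] the_inv_f_f)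
qed

text \<open>Independence makes the joint law a product measure; its density is checked on
  rectangles, where the integral factorises.\<close>

lemma distributed_vec:
  fixes Z :: "'i::finite \<Rightarrow> 'a \<Rightarrow> real" and \<phi> :: "'i \<Rightarrow> real \<Rightarrow> real"
  assumes indep: "indep_vars (\<lambda>_. borel) Z UNIV"
    and Z: "\<And>i. distributed M lborel (Z i) (\<phi> i)"
    and \<phi>: "\<And>i. \<phi> i \<in> borel_measurable borel" "\<And>i x. 0 \<le> \<phi> i x"
  shows "distributed M lborel (\<lambda>\<omega>. \<chi> i. Z i \<omega>) (\<lambda>z. ennreal (\<Prod>i\<in>UNIV. \<phi> i (z $ i)))"
proof -
  note [measurable] = \<phi>(1)
  have [measurable]: "Z i \<in> borel_measurable M" for i
    using Z[of i] by (simp add: distributed_def)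
  let ?D = "\<lambda>i. density lborel (\<phi> i)"
  have D: "distr M borel (Z i) = ?D i" for i
    using Z[of i] by (auto simp: distributed_def cong: distr_cong)
  have prob_D: "prob_space (?D i)" for i
    unfolding D[symmetric] by (rule prob_space_distr) simp
  interpret D: product_sigma_finite ?D
    unfolding product_sigma_finite_def by (intro allI prob_space_imp_sigma_finite prob_D)
  have joint: "distr M (PiM UNIV (\<lambda>_::'i. borel)) (\<lambda>\<omega> i. Z i \<omega>) = PiM UNIV ?D"
    using indep_vars_iff_distr_eq_PiM[where I=UNIV and M'="\<lambda>_. borel" and X=Z] indep
    by (simp add: D restrict_UNIV)
  have dens: "density (PiM UNIV (\<lambda>_::'i. lborel)) (\<lambda>x. \<Prod>i\<in>UNIV. ennreal (\<phi> i (x i))) = PiM UNIV ?D"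
  proof (rule D.PiM_eqI)
    fix A assume "\<And>i. i \<in> UNIV \<Longrightarrow> A i \<in> sets (?D i)"
    then have [measurable]: "A i \<in> sets borel" for i by simp
    have "emeasure (density (PiM UNIV (\<lambda>_::'i. lborel)) (\<lambda>x. \<Prod>i\<in>UNIV. ennreal (\<phi> i (x i)))) (Pi\<^sub>E UNIV A)
        = (\<integral>\<^sup>+x. (\<Prod>i\<in>UNIV. ennreal (\<phi> i (x i))) * indicator (Pi\<^sub>E UNIV A) x \<partial>PiM UNIV (\<lambda>_. lborel))"
      by (rule emeasure_density) (auto intro!: sets_PiM_I_finite)
    also have "\<dots> = (\<integral>\<^sup>+x. (\<Prod>i\<in>UNIV. ennreal (\<phi> i (x i)) * indicator (A i) (x i)) \<partial>PiM UNIV (\<lambda>_. lborel))"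
    proof (rule nn_integral_cong)
      fix x :: "'i \<Rightarrow> real"
      have "(indicator (Pi\<^sub>E UNIV A) x :: ennreal) = (\<Prod>i\<in>UNIV. indicator (A i) (x i))"
      proof (cases "x \<in> Pi\<^sub>E UNIV A")
        case False
        then obtain i where "x i \<notin> A i"
          by (auto simp: PiE_iff)
        then have "(\<Prod>i\<in>UNIV. indicator (A i) (x i)) = (0::ennreal)"
          by (intro prod_zero) (auto intro!: exI[of _ i])
        with False show ?thesis by simp
      next
        case True
        then have "x i \<in> A i" for i
          by (auto simp: PiE_iff)
        with True show ?thesis by simp
      qed
      then show "(\<Prod>i\<in>UNIV. ennreal (\<phi> i (x i))) * indicator (Pi\<^sub>E UNIV A) x
          = (\<Prod>i\<in>UNIV. ennreal (\<phi> i (x i)) * indicator (A i) (x i))"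
        by (simp add: prod.distrib)
    qed
    also have "\<dots> = (\<Prod>i\<in>UNIV. \<integral>\<^sup>+x. ennreal (\<phi> i x) * indicator (A i) x \<partial>lborel)"
      by (rule lborel_product.product_nn_integral_prod) auto
    also have "\<dots> = (\<Prod>i\<in>UNIV. emeasure (?D i) (A i))"
      by (simp add: emeasure_density)
    finally show "emeasure (density (PiM UNIV (\<lambda>_::'i. lborel)) (\<lambda>x. \<Prod>i\<in>UNIV. ennreal (\<phi> i (x i)))) (Pi\<^sub>E UNIV A)
        = (\<Prod>i\<in>UNIV. emeasure (?D i) (A i))" .
  qed (auto intro!: sets_PiM_cong)
  have "distr M lborel (\<lambda>\<omega>. \<chi> i. Z i \<omega>) = density lborel (\<lambda>z. ennreal (\<Prod>i\<in>UNIV. \<phi> i (z $ i)))"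
  proof (rule measure_eqI)
    fix A :: "(real^'i) set" assume "A \<in> sets (distr M lborel (\<lambda>\<omega>. \<chi> i. Z i \<omega>))"
    then have [measurable]: "A \<in> sets borel" by simp
    have "emeasure (distr M lborel (\<lambda>\<omega>. \<chi> i. Z i \<omega>)) A = (\<integral>\<^sup>+\<omega>. indicator A (\<chi> i. Z i \<omega>) \<partial>M)"
      by (simp add: nn_integral_distr flip: nn_integral_indicator)
    also have "\<dots> = (\<integral>\<^sup>+x. indicator A (\<chi> i. x i) \<partial>distr M (PiM UNIV (\<lambda>_::'i. borel)) (\<lambda>\<omega> i. Z i \<omega>))"
      by (rule nn_integral_distr[symmetric]) (measurable, intro measurable_abs_UNIV, measurable)
    also have "\<dots> = (\<integral>\<^sup>+x. (\<Prod>i\<in>UNIV. ennreal (\<phi> i (x i))) * indicator A (\<chi> i. x i) \<partial>PiM UNIV (\<lambda>_::'i. lborel))"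
      unfolding joint dens[symmetric] by (rule nn_integral_density) measurable
    also have "\<dots> = (\<integral>\<^sup>+z. ennreal (\<Prod>i\<in>UNIV. \<phi> i (z $ i)) * indicator A z \<partial>lborel)"
      by (subst nn_integral_lborel_vec) (simp_all add: prod_ennreal \<phi>(2))
    also have "\<dots> = emeasure (density lborel (\<lambda>z. ennreal (\<Prod>i\<in>UNIV. \<phi> i (z $ i)))) A"
      by (simp add: emeasure_density)
    finally show "emeasure (distr M lborel (\<lambda>\<omega>. \<chi> i. Z i \<omega>)) A
        = emeasure (density lborel (\<lambda>z. ennreal (\<Prod>i\<in>UNIV. \<phi> i (z $ i)))) A" .
  qed simp
  then show ?thesis
    by (simp add: distributed_def)
qed

section \<open>Expected log-likelihood ratios of Gaussian channels\<close>

lemma normal_second_moment: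
  assumes "0 < N" "distributed M lborel Z (normal_density 0 (sqrt N))"
  shows "has_bochner_integral M (\<lambda>\<omega>. (Z \<omega>)\<^sup>2) N" and "has_bochner_integral M Z 0"
proof -
  have \<sigma>: "0 < sqrt N"
    using assms(1) by simp
  have int: "integrable M (\<lambda>\<omega>. Z \<omega> ^ k)" for k
    using distributed_integrable[OF assms(2), of "\<lambda>x. x ^ k"] integrable_normal_moment[OF \<sigma>, of 0 k]
    by simp
  have "expectation Z = 0" "expectation (\<lambda>\<omega>. (Z \<omega>)\<^sup>2) = N"
    using normal_distributed_expectation[OF \<sigma> assms(2)] normal_distributed_variance[OF \<sigma> assms(2)] assms(1)
    by simp_all
  then show "has_bochner_integral M (\<lambda>\<omega>. (Z \<omega>)\<^sup>2) N" "has_bochner_integral M Z 0"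
    using int[of 1] int[of 2] by (simp_all only: has_bochner_integral_iff power_one_right simp_thms)
qed

text \<open>Kills the cross term of channel input and noise. The input is integrable because its
  power is finite.\<close>

lemma has_bochner_integral_mult_indep_zero:
  fixes S Z :: "'a \<Rightarrow> real"
  assumes "indep_var borel S borel Z"
    and "has_bochner_integral M (\<lambda>\<omega>. (S \<omega>)\<^sup>2) a" "has_bochner_integral M Z 0"
  shows "has_bochner_integral M (\<lambda>\<omega>. S \<omega> * Z \<omega>) 0"
proof -
  have "S \<in> borel_measurable M"
    using assms(1) by (rule indep_var_rv1)
  then have S: "integrable M S"
    by (rule square_integrable_imp_integrable[OF _ integrable.intros[OF assms(2)]])
  have Z: "integrable M Z" "expectation Z = 0"
    using assms(3) by (auto simp: has_bochner_integral_iff)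
  show ?thesis
    using indep_var_integrable[OF assms(1) S Z(1)] indep_var_lebesgue_integral[OF assms(1) S Z(1)] Z(2)
    by (simp add: has_bochner_integral_iff)
qed

lemma has_bochner_integral_constant: "has_bochner_integral M (\<lambda>_. c) c" for c :: real
  by (simp add: has_bochner_integral_iff prob_space)

text \<open>The log-ratio is quadratic in \<open>S\<close> and \<open>Z\<close>, so only second
  moments enter and \<open>S\<close> may have any law. The reference variance \<open>N + a\<close>
  is that of the output; the two quadratic terms therefore contribute -1/2 and 1/2, and minus the
  capacity remains.\<close>

lemma gaussian_scalar_rate:
  assumes N: "0 < N" and a: "0 \<le> a"
    and "has_bochner_integral M (\<lambda>\<omega>. (S \<omega>)\<^sup>2) a" "has_bochner_integral M (\<lambda>\<omega>. (Z \<omega>)\<^sup>2) N"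
      "has_bochner_integral M (\<lambda>\<omega>. S \<omega> * Z \<omega>) 0"
  shows "has_bochner_integral M
    (\<lambda>\<omega>. ln (normal_density 0 (sqrt (N + a)) (S \<omega> + Z \<omega>) / normal_density 0 (sqrt N) (Z \<omega>)))
    (- (1 / 2 * ln (1 + a / N)))"
proof -
  have ln_nd: "ln (normal_density 0 (sqrt v) x) = - (ln (2 * pi * v) / 2) - x\<^sup>2 / (2 * v)" if "0 < v" for v x
    using that by (simp add: normal_density_def ln_div ln_mult_pos ln_sqrt)
  have eq: "ln (normal_density 0 (sqrt (N + a)) (S \<omega> + Z \<omega>) / normal_density 0 (sqrt N) (Z \<omega>))
      = - (1 / 2 * ln (1 + a / N)) - (1 / (2 * (N + a))) * ((S \<omega>)\<^sup>2 + (2 * (S \<omega> * Z \<omega>) + (Z \<omega>)\<^sup>2))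
        + (1 / (2 * N)) * (Z \<omega>)\<^sup>2" for \<omega>
  proof -
    have "ln (normal_density 0 (sqrt (N + a)) (S \<omega> + Z \<omega>) / normal_density 0 (sqrt N) (Z \<omega>))
        = - (ln (2 * pi * (N + a)) / 2) + ln (2 * pi * N) / 2 - (S \<omega> + Z \<omega>)\<^sup>2 / (2 * (N + a)) + (Z \<omega>)\<^sup>2 / (2 * N)"
      using N a by (subst ln_div) (auto simp: ln_nd normal_density_pos less_imp_neq[symmetric])
    moreover have "1 + a / N = (N + a) / N"
      using N by (simp add: field_simps)
    then have "ln (2 * pi * (N + a)) - ln (2 * pi * N) = ln (1 + a / N)"
      using N a by (simp add: ln_mult_pos ln_div)
    moreover have "(S \<omega> + Z \<omega>)\<^sup>2 / (2 * (N + a)) = (1 / (2 * (N + a))) * ((S \<omega>)\<^sup>2 + (2 * (S \<omega> * Z \<omega>) + (Z \<omega>)\<^sup>2))"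
      by (simp add: power2_sum algebra_simps add_divide_distrib)
    moreover have "(Z \<omega>)\<^sup>2 / (2 * N) = (1 / (2 * N)) * (Z \<omega>)\<^sup>2"
      by simp
    ultimately show ?thesis
      by linarith
  qed
  have "has_bochner_integral M (\<lambda>\<omega>. - (1 / 2 * ln (1 + a / N))
        - (1 / (2 * (N + a))) * ((S \<omega>)\<^sup>2 + (2 * (S \<omega> * Z \<omega>) + (Z \<omega>)\<^sup>2)) + (1 / (2 * N)) * (Z \<omega>)\<^sup>2)
      (- (1 / 2 * ln (1 + a / N)) - (1 / (2 * (N + a))) * (a + (2 * 0 + N)) + (1 / (2 * N)) * N)"
    using assms(3-5)
    by (intro has_bochner_integral_add[OF has_bochner_integral_diff[OF has_bochner_integral_constant
        has_bochner_integral_mult_right[OF has_bochner_integral_add[OF _ has_bochner_integral_add[OF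
        has_bochner_integral_mult_right]]]] has_bochner_integral_mult_right])
  moreover have "(1 / (2 * (N + a))) * (a + (2 * 0 + N)) = 1 / 2" "(1 / (2 * N)) * N = 1 / 2"
    using N a by (simp_all add: field_simps)
  then have "- (1 / 2 * ln (1 + a / N)) - (1 / (2 * (N + a))) * (a + (2 * 0 + N)) + (1 / (2 * N)) * N
      = - (1 / 2 * ln (1 + a / N))"
    by linarith
  ultimately show ?thesis
    unfolding eq by (simp only:)
qed

text \<open>The logarithm adds over the channels, so linearity of expectation gives the sum even
  when the inputs of different channels are dependent.\<close>

lemma gaussian_vector_rate:
  fixes N a :: "'l::finite \<Rightarrow> real" and S V :: "'a \<Rightarrow> real^'l"
  assumes "\<And>i. 0 < N i" "\<And>i. 0 \<le> a i"
    and "\<And>i. has_bochner_integral M (\<lambda>\<omega>. (S \<omega> $ i)\<^sup>2) (a i)"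
      "\<And>i. has_bochner_integral M (\<lambda>\<omega>. (V \<omega> $ i)\<^sup>2) (N i)"
      "\<And>i. has_bochner_integral M (\<lambda>\<omega>. S \<omega> $ i * V \<omega> $ i) 0"
  shows "has_bochner_integral M
    (\<lambda>\<omega>. ln ((\<Prod>i\<in>UNIV. normal_density 0 (sqrt (N i + a i)) ((S \<omega> + V \<omega>) $ i)) /
      (\<Prod>i\<in>UNIV. normal_density 0 (sqrt (N i)) (V \<omega> $ i))))
    (- (\<Sum>i\<in>UNIV. 1 / 2 * ln (1 + a i / N i)))"
proof -
  have Na: "0 < N i + a i" for i
    using assms(1,2)[of i] by linarith
  have nz: "normal_density 0 (sqrt (N i + a i)) x \<noteq> 0" "normal_density 0 (sqrt (N i)) x \<noteq> 0" for i x
    using normal_density_pos[of "sqrt (N i + a i)" 0 x] normal_density_pos[of "sqrt (N i)" 0 x] Na[of i] assms(1)[of i]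
    by simp_all
  have "ln ((\<Prod>i\<in>UNIV. normal_density 0 (sqrt (N i + a i)) ((S \<omega> + V \<omega>) $ i)) /
      (\<Prod>i\<in>UNIV. normal_density 0 (sqrt (N i)) (V \<omega> $ i)))
    = (\<Sum>i\<in>UNIV. ln (normal_density 0 (sqrt (N i + a i)) (S \<omega> $ i + V \<omega> $ i) /
        normal_density 0 (sqrt (N i)) (V \<omega> $ i)))" for \<omega>
    unfolding prod_dividef[symmetric] by (subst ln_prod) (auto simp: nz)
  moreover have "has_bochner_integral M (\<lambda>\<omega>. \<Sum>i\<in>UNIV. ln (normal_density 0 (sqrt (N i + a i)) (S \<omega> $ i + V \<omega> $ i) /
        normal_density 0 (sqrt (N i)) (V \<omega> $ i))) (\<Sum>i\<in>UNIV. - (1 / 2 * ln (1 + a i / N i)))"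
    by (intro has_bochner_integral_sum gaussian_scalar_rate assms)
  ultimately show ?thesis
    by (simp add: sum_negf)
qed

text \<open>The noise part of the matched filter output, the sufficient statistic for one symbol
  seen through all channels at once. Its variance is the sum of
  \<open>N i / (N i)\<^sup>2\<close>.\<close>

lemma normal_weighted_sum:
  fixes N :: "'l::finite \<Rightarrow> real"
  assumes N: "\<And>i. 0 < N i" and indep: "indep_vars (\<lambda>_. borel) Z UNIV"
    and Z: "\<And>i. distributed M lborel (Z i) (normal_density 0 (sqrt (N i)))"
  shows "distributed M lborel (\<lambda>\<omega>. \<Sum>i\<in>UNIV. Z i \<omega> / N i) (normal_density 0 (sqrt (\<Sum>i\<in>UNIV. 1 / N i)))"
proof -
  have "distributed M lborel (\<lambda>\<omega>. Z i \<omega> / N i) (normal_density 0 (sqrt (N i) / N i))" for i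
    using normal_density_affine[OF Z[of i], of "1 / N i" 0] N[of i] by simp
  moreover have "indep_vars (\<lambda>_. borel) (\<lambda>i \<omega>. Z i \<omega> / N i) UNIV"
    using indep by (rule indep_vars_compose2) simp
  ultimately have "distributed M lborel (\<lambda>\<omega>. \<Sum>i\<in>UNIV. Z i \<omega> / N i)
      (normal_density (\<Sum>i\<in>(UNIV::'l set). 0) (sqrt (\<Sum>i\<in>UNIV. (sqrt (N i) / N i)\<^sup>2)))"
    using N by (intro sum_indep_normal) auto
  moreover have "(sqrt (N i) / N i)\<^sup>2 = 1 / N i" for i
    using N[of i] by (simp add: power_divide power2_eq_square)
  ultimately show ?thesis
    by simp
qed

text \<open>\<open>simo_density\<close> is the noise density times a function \<open>e\<close> of
  the matched filter output alone, so its mass is the mean of \<open>e\<close> under a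
  one-dimensional Gaussian. The factor \<open>e\<close> turns variance \<open>\<sigma>\<close> into
  \<open>\<sigma> * (1 + a * \<sigma>)\<close>, the variance of that statistic in the presence of an
  independent signal of power \<open>a\<close>.\<close>

lemma nn_integral_simo_density:
  fixes N :: "'l::finite \<Rightarrow> real"
  assumes N: "\<And>i. 0 < N i" and a: "0 \<le> a"
    and V: "distributed M lborel V (\<lambda>z. ennreal (\<Prod>i\<in>UNIV. normal_density 0 (sqrt (N i)) (z $ i)))"
    and G: "distributed M lborel (\<lambda>\<omega>. \<Sum>i\<in>UNIV. V \<omega> $ i / N i) (normal_density 0 (sqrt (\<Sum>i\<in>UNIV. 1 / N i)))"
  shows "(\<integral>\<^sup>+y. ennreal (simo_density N a y) \<partial>lborel) = 1"
proof -
  define \<sigma> where "\<sigma> = (\<Sum>i\<in>UNIV. 1 / N i)"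
  define \<kappa> where "\<kappa> = a / (1 + a * \<sigma>)"
  have \<sigma>: "0 < \<sigma>"
    unfolding \<sigma>_def using N by (intro sum_pos) auto
  then have pos: "0 < 1 + a * \<sigma>"
    using a by (intro add_pos_nonneg) auto
  define e where "e x = exp (\<kappa> / 2 * x\<^sup>2) / sqrt (1 + a * \<sigma>)" for x
  have [measurable]: "e \<in> borel_measurable borel"
    unfolding e_def by measurable
  have e_nn: "0 \<le> e x" for x
    using pos by (simp add: e_def)
  have "(\<integral>\<^sup>+y. ennreal (simo_density N a y) \<partial>lborel)
      = (\<integral>\<^sup>+y. ennreal (\<Prod>i\<in>UNIV. normal_density 0 (sqrt (N i)) (y $ i)) * ennreal (e (\<Sum>i\<in>UNIV. y $ i / N i)) \<partial>lborel)"
  proof (rule nn_integral_cong)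
    fix y :: "real^'l"
    have "simo_density N a y = (\<Prod>i\<in>UNIV. normal_density 0 (sqrt (N i)) (y $ i)) * e (\<Sum>i\<in>UNIV. y $ i / N i)"
      by (simp add: simo_density_def e_def \<kappa>_def \<sigma>_def)
    then show "ennreal (simo_density N a y)
        = ennreal (\<Prod>i\<in>UNIV. normal_density 0 (sqrt (N i)) (y $ i)) * ennreal (e (\<Sum>i\<in>UNIV. y $ i / N i))"
      by (simp add: ennreal_mult prod_nonneg e_nn)
  qed
  also have "\<dots> = (\<integral>\<^sup>+\<omega>. ennreal (e (\<Sum>i\<in>UNIV. V \<omega> $ i / N i)) \<partial>M)"
    by (rule distributed_nn_integral[OF V]) measurable
  also have "\<dots> = (\<integral>\<^sup>+x. ennreal (normal_density 0 (sqrt \<sigma>) x) * ennreal (e x) \<partial>lborel)"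
    using distributed_nn_integral[OF G, of "\<lambda>x. ennreal (e x)"] by (simp add: \<sigma>_def)
  also have "\<dots> = (\<integral>\<^sup>+x. ennreal (normal_density 0 (sqrt (\<sigma> * (1 + a * \<sigma>))) x) \<partial>lborel)"
  proof (rule nn_integral_cong)
    fix x
    have "\<kappa> / 2 * x\<^sup>2 - x\<^sup>2 / (2 * \<sigma>) = - x\<^sup>2 / (2 * (\<sigma> * (1 + a * \<sigma>)))"
      using \<sigma> pos by (simp add: \<kappa>_def divide_simps) (simp add: algebra_simps)
    then have "exp (\<kappa> / 2 * x\<^sup>2) * exp (- x\<^sup>2 / (2 * \<sigma>)) = exp (- x\<^sup>2 / (2 * (\<sigma> * (1 + a * \<sigma>))))"
      by (simp flip: exp_add)
    moreover have "normal_density 0 (sqrt \<sigma>) x * e x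
        = exp (\<kappa> / 2 * x\<^sup>2) * exp (- x\<^sup>2 / (2 * \<sigma>)) / (sqrt (2 * pi * \<sigma>) * sqrt (1 + a * \<sigma>))"
      unfolding normal_density_sqrt[OF \<sigma>] e_def by simp
    moreover have "sqrt (2 * pi * \<sigma>) * sqrt (1 + a * \<sigma>) = sqrt (2 * pi * (\<sigma> * (1 + a * \<sigma>)))"
      by (simp add: real_sqrt_mult)
    ultimately have "normal_density 0 (sqrt \<sigma>) x * e x = normal_density 0 (sqrt (\<sigma> * (1 + a * \<sigma>))) x"
      using \<sigma> pos by (simp only: normal_density_sqrt mult_pos_pos)
    then show "ennreal (normal_density 0 (sqrt \<sigma>) x) * ennreal (e x)
        = ennreal (normal_density 0 (sqrt (\<sigma> * (1 + a * \<sigma>))) x)"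
      by (simp add: ennreal_mult[symmetric] e_nn)
  qed
  also have "\<dots> = 1"
    using \<sigma> pos by (intro nn_integral_normal_density) simp
  finally show ?thesis .
qed

text \<open>The log-ratio involves the noise vector only through \<open>G\<close> and is quadratic
  in \<open>S\<close> and \<open>G\<close>. Since \<open>\<kappa> * (1 + a * \<sigma>) = a\<close>,
  the quadratic part has mean zero, which leaves minus the capacity of one symbol sent to all
  receivers.\<close>

lemma simo_rate:
  fixes N :: "'l::finite \<Rightarrow> real" and S :: "'a \<Rightarrow> real" and V :: "'a \<Rightarrow> real^'l"
  defines "\<sigma> \<equiv> \<Sum>i\<in>UNIV. 1 / N i" and "G \<equiv> \<lambda>\<omega>. \<Sum>i\<in>UNIV. V \<omega> $ i / N i"
  assumes N: "\<And>i. 0 < N i" and a: "0 \<le> a"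
    and moments: "has_bochner_integral M (\<lambda>\<omega>. (S \<omega>)\<^sup>2) a" "has_bochner_integral M (\<lambda>\<omega>. (G \<omega>)\<^sup>2) \<sigma>"
      "has_bochner_integral M (\<lambda>\<omega>. S \<omega> * G \<omega>) 0"
  shows "has_bochner_integral M
    (\<lambda>\<omega>. ln (simo_density N a ((\<chi> i. S \<omega>) + V \<omega>) / (\<Prod>i\<in>UNIV. normal_density 0 (sqrt (N i)) (V \<omega> $ i))))
    (- (1 / 2 * ln (1 + a * \<sigma>)))"
proof -
  define \<kappa> where "\<kappa> = a / (1 + a * \<sigma>)"
  have \<sigma>: "0 \<le> \<sigma>"
    unfolding \<sigma>_def using N by (intro sum_nonneg) (auto simp: less_imp_le)
  then have pos: "0 < 1 + a * \<sigma>"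
    using a by (intro add_pos_nonneg) auto
  have nz: "normal_density 0 (sqrt (N i)) x \<noteq> 0" for i x
    using normal_density_pos[of "sqrt (N i)" 0 x] N[of i] by simp
  have eq: "ln (simo_density N a ((\<chi> i. S \<omega>) + V \<omega>) / (\<Prod>i\<in>UNIV. normal_density 0 (sqrt (N i)) (V \<omega> $ i)))
      = - (1 / 2 * ln (1 + a * \<sigma>)) + ((\<kappa> / 2 * \<sigma>\<^sup>2 - \<sigma> / 2) * (S \<omega>)\<^sup>2
        + ((\<kappa> * \<sigma> - 1) * (S \<omega> * G \<omega>) + \<kappa> / 2 * (G \<omega>)\<^sup>2))" for \<omega>
  proof -
    have ratio: "ln (normal_density 0 (sqrt (N i)) (S \<omega> + V \<omega> $ i) / normal_density 0 (sqrt (N i)) (V \<omega> $ i))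
        = - (1 / 2 * (S \<omega>)\<^sup>2) * (1 / N i) - S \<omega> * (V \<omega> $ i / N i)" for i
    proof -
      have "normal_density 0 (sqrt (N i)) (S \<omega> + V \<omega> $ i) / normal_density 0 (sqrt (N i)) (V \<omega> $ i)
          = exp (- (S \<omega> + V \<omega> $ i)\<^sup>2 / (2 * N i) - - (V \<omega> $ i)\<^sup>2 / (2 * N i))"
        using N[of i] unfolding normal_density_sqrt[OF N] exp_diff by simp
      then show ?thesis
        using N[of i] by (simp add: power2_sum field_simps)
    qed
    define P where "P = (\<Prod>i\<in>UNIV. normal_density 0 (sqrt (N i)) (S \<omega> + V \<omega> $ i) / normal_density 0 (sqrt (N i)) (V \<omega> $ i))"
    have G': "(\<Sum>i\<in>UNIV. (S \<omega> + V \<omega> $ i) / N i) = S \<omega> * \<sigma> + G \<omega>"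
      by (simp add: \<sigma>_def G_def add_divide_distrib sum.distrib sum_distrib_left)
    have "simo_density N a ((\<chi> i. S \<omega>) + V \<omega>) / (\<Prod>i\<in>UNIV. normal_density 0 (sqrt (N i)) (V \<omega> $ i))
        = exp (\<kappa> / 2 * (S \<omega> * \<sigma> + G \<omega>)\<^sup>2) / sqrt (1 + a * \<sigma>) * P"
      by (simp add: simo_density_def P_def prod_dividef \<kappa>_def G' flip: \<sigma>_def)
    moreover have "P > 0"
      unfolding P_def using N by (intro prod_pos) (auto intro!: divide_pos_pos normal_density_pos)
    then have "ln (exp (\<kappa> / 2 * (S \<omega> * \<sigma> + G \<omega>)\<^sup>2) / sqrt (1 + a * \<sigma>) * P)
        = ln (exp (\<kappa> / 2 * (S \<omega> * \<sigma> + G \<omega>)\<^sup>2) / sqrt (1 + a * \<sigma>)) + ln P"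
      using pos by (intro ln_mult_pos divide_pos_pos) auto
    moreover have "ln (exp (\<kappa> / 2 * (S \<omega> * \<sigma> + G \<omega>)\<^sup>2) / sqrt (1 + a * \<sigma>))
        = \<kappa> / 2 * (S \<omega> * \<sigma> + G \<omega>)\<^sup>2 - ln (1 + a * \<sigma>) / 2"
      using pos by (subst ln_div) (auto simp: ln_sqrt)
    moreover have "ln P = - (1 / 2 * (S \<omega>)\<^sup>2) * \<sigma> - S \<omega> * G \<omega>"
      unfolding P_def \<sigma>_def G_def sum_distrib_left sum_subtractf[symmetric] ratio[symmetric]
      by (rule ln_prod) (auto simp: nz)
    ultimately have "ln (simo_density N a ((\<chi> i. S \<omega>) + V \<omega>) / (\<Prod>i\<in>UNIV. normal_density 0 (sqrt (N i)) (V \<omega> $ i)))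
        = \<kappa> / 2 * (S \<omega> * \<sigma> + G \<omega>)\<^sup>2 - ln (1 + a * \<sigma>) / 2 + (- (1 / 2 * (S \<omega>)\<^sup>2) * \<sigma> - S \<omega> * G \<omega>)"
      by simp
    then show ?thesis
      by (simp add: power2_eq_square algebra_simps)
  qed
  have "has_bochner_integral M (\<lambda>\<omega>. - (1 / 2 * ln (1 + a * \<sigma>)) + ((\<kappa> / 2 * \<sigma>\<^sup>2 - \<sigma> / 2) * (S \<omega>)\<^sup>2
        + ((\<kappa> * \<sigma> - 1) * (S \<omega> * G \<omega>) + \<kappa> / 2 * (G \<omega>)\<^sup>2)))
      (- (1 / 2 * ln (1 + a * \<sigma>)) + ((\<kappa> / 2 * \<sigma>\<^sup>2 - \<sigma> / 2) * a + ((\<kappa> * \<sigma> - 1) * 0 + \<kappa> / 2 * \<sigma>)))"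
    using moments
    by (intro has_bochner_integral_add[OF has_bochner_integral_constant
        has_bochner_integral_add[OF has_bochner_integral_mult_right has_bochner_integral_add[OF
        has_bochner_integral_mult_right has_bochner_integral_mult_right]]])
  moreover have "(\<kappa> / 2 * \<sigma>\<^sup>2 - \<sigma> / 2) * a + ((\<kappa> * \<sigma> - 1) * 0 + \<kappa> / 2 * \<sigma>) = 0"
  proof -
    have "\<kappa> * (1 + a * \<sigma>) = a"
      using pos by (simp add: \<kappa>_def)
    then have "\<sigma> / 2 * (\<kappa> * (1 + a * \<sigma>)) = \<sigma> / 2 * a"
      by simp
    then show ?thesis
      by (simp add: power2_eq_square algebra_simps)
  qed
  ultimately show ?thesis
    unfolding eq by simp
qed

end

section \<open>The parallel network\<close>

text \<open>Zero-state response of the plant to the input \<open>v\<close>; by linearity the state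
  is the free motion of the initial state plus this.\<close>

primrec drift :: "real^'n^'n \<Rightarrow> (nat \<Rightarrow> real^'n) \<Rightarrow> nat \<Rightarrow> real^'n" where
  "drift A v 0 = 0"
| "drift A v (Suc t) = A *v drift A v t + v t"

lemma drift_cong: "(\<And>s. s < t \<Longrightarrow> v s = v' s) \<Longrightarrow> drift A v t = drift A v' t"
  by (induction t) auto

lemma measurable_matrix_vector_mult:
  fixes A :: "real^'m^'n"
  assumes "f \<in> borel_measurable L"
  shows "(\<lambda>x. A *v f x) \<in> borel_measurable L"
  using assms
  by (rule measurable_compose) (intro borel_measurable_continuous_onI matrix_vector_mult_linear_continuous_on)

lemma measurable_drift:
  assumes "\<And>s. (\<lambda>x. v x s) \<in> borel_measurable L"
  shows "(\<lambda>x. drift A (v x) t) \<in> borel_measurable L"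
  using assms by (induction t) (auto intro!: borel_measurable_add measurable_matrix_vector_mult)

lemma Int_stable_generated_events: "Int_stable (generated_events M h)"
proof (rule Int_stableI)
  fix a b assume "a \<in> generated_events M h" "b \<in> generated_events M h"
  then obtain E F where "E \<in> sets borel" "F \<in> sets borel" "a = h -` E \<inter> space M" "b = h -` F \<inter> space M"
    by (auto simp: generated_events_def)
  then have "E \<inter> F \<in> sets borel" "a \<inter> b = h -` (E \<inter> F) \<inter> space M"
    by auto
  then show "a \<inter> b \<in> generated_events M h"
    unfolding generated_events_def by blast
qed

text \<open>The closed loop shared by both hop bounds. The relay powers are those in use,
  \<open>P_used\<close>; they are compared with the water-filling powers only afterwards.\<close>

locale parallel_network = prob_space M
  for M :: "'a measure"
    and A :: "real^'n^'n" and B :: "real^'m^'n"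
    and X :: "nat \<Rightarrow> 'a \<Rightarrow> real^'n" and U :: "nat \<Rightarrow> 'a \<Rightarrow> real^'m"
    and W :: "nat \<Rightarrow> 'a \<Rightarrow> real^'n"
    and Se :: "nat \<Rightarrow> 'a \<Rightarrow> real"
    and Y Sr R Zr Zd :: "'l::finite \<Rightarrow> nat \<Rightarrow> 'a \<Rightarrow> real"
    and f :: "nat \<Rightarrow> (nat \<Rightarrow> real^'n) \<times> (nat \<Rightarrow> real^'m) \<Rightarrow> real"
    and g :: "'l \<Rightarrow> nat \<Rightarrow> (nat \<Rightarrow> real) \<Rightarrow> real"
    and \<pi> :: "nat \<Rightarrow> ('l \<times> nat \<Rightarrow> real) \<Rightarrow> real^'m"
    and P_S :: real
    and Nr Nd P_used :: "'l \<Rightarrow> real" +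
  assumes X0_entropy: "finite_differential_entropy M (X 0)"
    and plant: "\<And>t w. w \<in> space M \<Longrightarrow> X (Suc t) w = A *v X t w + B *v U t w + W t w"
    and Nr_pos: "\<And>i. 0 < Nr i"
    and Nd_pos: "\<And>i. 0 < Nd i"
    and Zr_gauss: "\<And>i t. distributed M lborel (Zr i t) (normal_density 0 (sqrt (Nr i)))"
    and Zd_gauss: "\<And>i t. distributed M lborel (Zd i t) (normal_density 0 (sqrt (Nd i)))"
    and indep: "independent_sources M (X 0) W Zr Zd"
    and f_meas: "\<And>t. f t \<in> borel_measurable
                   (PiM {0..t} (\<lambda>_. borel) \<Otimes>\<^sub>M PiM {0..<t} (\<lambda>_. borel))"
    and g_meas: "\<And>i t. g i t \<in> borel_measurable (PiM {0..<t} (\<lambda>_. borel))"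
    and \<pi>_meas: "\<And>t. \<pi> t \<in> borel_measurable (PiM (UNIV \<times> {0..t}) (\<lambda>_. borel))"
    and encoder: "\<And>t w. w \<in> space M \<Longrightarrow> Se t w =
        (if odd t then f t (\<lambda>s\<in>{0..t}. X s w, \<lambda>s\<in>{0..<t}. U s w) else 0)"
    and relay_in: "\<And>i t w. w \<in> space M \<Longrightarrow> Y i t w =
        (if odd t then Se t w + Zr i t w else 0)"
    and relay_out: "\<And>i t w. w \<in> space M \<Longrightarrow> Sr i t w =
        (if even t \<and> 0 < t then g i t (\<lambda>s\<in>{0..<t}. Y i s w) else 0)"
    and received: "\<And>i t w. w \<in> space M \<Longrightarrow> R i t w =
        (if even t \<and> 0 < t then Sr i t w + Zd i t w else 0)"
    and controller: "\<And>t w. w \<in> space M \<Longrightarrow>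
        U t w = \<pi> t (\<lambda>(i, s)\<in>UNIV \<times> {0..t}. R i s w)"
    and power_S: "\<And>t. odd t \<Longrightarrow> has_bochner_integral M (\<lambda>w. (Se t w)\<^sup>2) (2 * P_S)"
    and power_r: "\<And>i t. even t \<Longrightarrow> 0 < t \<Longrightarrow>
        has_bochner_integral M (\<lambda>w. (Sr i t w)\<^sup>2) (2 * P_used i)"
    and stable: "mean_square_stable M X"
begin

section \<open>Independent sources and causality\<close>

definition source_events :: "'l source \<Rightarrow> 'a set set" where
  "source_events s = (case s of
      Initial \<Rightarrow> generated_events M (X 0)
    | Plant t \<Rightarrow> generated_events M (W t)
    | Relay_noise i t \<Rightarrow> generated_events M (Zr i t)
    | Dest_noise i t \<Rightarrow> generated_events M (Zd i t))"

text \<open>Side information is described by the set of sources it may depend on, so that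
  independence follows from disjointness of such sets.\<close>

definition source_algebra :: "'l source set \<Rightarrow> 'a measure" where
  "source_algebra I = sigma (space M) (\<Union>s\<in>I. source_events s)"

lemma indep_source_events: "indep_sets source_events UNIV"
  using indep unfolding independent_sources_def source_events_def .

lemma source_events_Pow: "(\<Union>s\<in>I. source_events s) \<subseteq> Pow (space M)"
  by (auto simp: source_events_def generated_events_def split: source.splits)

lemma Int_stable_source_events: "Int_stable (source_events s)"
  by (simp add: source_events_def Int_stable_generated_events split: source.split)

lemma space_source_algebra [simp]: "space (source_algebra I) = space M"
  by (simp add: source_algebra_def space_measure_of source_events_Pow)

lemma indep_of_source_algebra:
  assumes "I \<inter> J = {}" "V \<in> borel_measurable (source_algebra J)"
  shows "indep_of (source_algebra I) V"
  using indep_of_sigma[OF indep_source_events Int_stable_source_events] assms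
  unfolding source_algebra_def by blast

lemma source_algebra_mono: "I \<subseteq> J \<Longrightarrow> (\<lambda>\<omega>. \<omega>) \<in> source_algebra J \<rightarrow>\<^sub>M source_algebra I"
  unfolding source_algebra_def[of I]
proof (rule measurable_measure_of[OF source_events_Pow])
  fix y assume "I \<subseteq> J" "y \<in> (\<Union>s\<in>I. source_events s)"
  moreover from this have "y \<subseteq> space M"
    using source_events_Pow[of I] by auto
  ultimately have "y \<in> sigma_sets (space M) (\<Union>s\<in>J. source_events s)" "y \<inter> space M = y"
    by (auto intro!: sigma_sets.Basic)
  then show "(\<lambda>\<omega>. \<omega>) -` y \<inter> space (source_algebra J) \<in> sets (source_algebra J)"
    by (simp add: source_algebra_def space_measure_of sets_measure_of source_events_Pow)
qed simp

lemma measurable_source: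
  assumes "s \<in> I" "source_events s = generated_events M h"
  shows "h \<in> borel_measurable (source_algebra I)"
proof (rule measurableI)
  fix E assume "E \<in> sets (borel :: 'b measure)"
  then have "h -` E \<inter> space M \<in> (\<Union>s\<in>I. source_events s)"
    using assms unfolding generated_events_def by auto
  then show "h -` E \<inter> space (source_algebra I) \<in> sets (source_algebra I)"
    unfolding space_source_algebra
    by (simp add: source_algebra_def sets_measure_of source_events_Pow sigma_sets.Basic)
qed simp

lemma measurable_sources:
  "Initial \<in> I \<Longrightarrow> X 0 \<in> borel_measurable (source_algebra I)"
  "Plant t \<in> I \<Longrightarrow> W t \<in> borel_measurable (source_algebra I)"
  "Relay_noise i t \<in> I \<Longrightarrow> Zr i t \<in> borel_measurable (source_algebra I)"
  "Dest_noise i t \<in> I \<Longrightarrow> Zd i t \<in> borel_measurable (source_algebra I)"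
  by (auto intro!: measurable_source simp: source_events_def)

text \<open>Causality, by strong induction around the loop: what is sent at time \<open>t\<close>
  involves channel noises of earlier times only, so \<open>I\<close> may leave out those of time
  \<open>t\<close> itself. \<open>Y\<close> and \<open>R\<close> are covered only before
  \<open>t\<close> because they contain the noise of their own time.\<close>

lemma measurable_signals:
  assumes "Initial \<in> I" "\<And>t. Plant t \<in> I"
    and "\<And>i s. s < t \<Longrightarrow> Relay_noise i s \<in> I" "\<And>i s. s < t \<Longrightarrow> Dest_noise i s \<in> I"
  shows "Se t \<in> borel_measurable (source_algebra I) \<and>
    (\<forall>i. Sr i t \<in> borel_measurable (source_algebra I)) \<and> X t \<in> borel_measurable (source_algebra I) \<and>
    (\<forall>i. \<forall>s<t. Y i s \<in> borel_measurable (source_algebra I) \<and> R i s \<in> borel_measurable (source_algebra I))"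
  using assms
proof (induction t rule: less_induct)
  case (less t)
  let ?L = "source_algebra I"
  have IH: "Se s \<in> borel_measurable ?L" "Sr i s \<in> borel_measurable ?L" "X s \<in> borel_measurable ?L"
    if "s < t" for s i
    using less.IH[OF that] less.prems that by auto
  have Y [measurable]: "Y i s \<in> borel_measurable ?L" if "s < t" for i s
  proof -
    have [measurable]: "Se s \<in> borel_measurable ?L" "Zr i s \<in> borel_measurable ?L"
      using IH[OF that] less.prems that by (auto intro: measurable_sources)
    have "(\<lambda>w. if odd s then Se s w + Zr i s w else 0) \<in> borel_measurable ?L"
      by measurable
    then show ?thesis
      by (subst measurable_cong[OF relay_in]) auto
  qed
  have R [measurable]: "R i s \<in> borel_measurable ?L" if "s < t" for i s
  proof -
    have [measurable]: "Sr i s \<in> borel_measurable ?L" "Zd i s \<in> borel_measurable ?L"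
      using IH[OF that] less.prems that by (auto intro: measurable_sources)
    have "(\<lambda>w. if even s \<and> 0 < s then Sr i s w + Zd i s w else 0) \<in> borel_measurable ?L"
      by measurable
    then show ?thesis
      by (subst measurable_cong[OF received]) auto
  qed
  have U: "U s \<in> borel_measurable ?L" if "s < t" for s
  proof -
    have "(\<lambda>w. \<lambda>(i, s)\<in>UNIV \<times> {0..s}. R i s w) \<in> ?L \<rightarrow>\<^sub>M PiM (UNIV \<times> {0..s}) (\<lambda>_. borel)"
      using that by (intro measurable_restrict) (auto split: prod.split)
    from measurable_compose[OF this \<pi>_meas[of s]] show ?thesis
      by (subst measurable_cong[OF controller]) auto
  qed
  \<comment> \<open>One step further than for the control: the encoder at time \<open>t\<close>
    observes \<open>X t\<close>, which the plant recursion builds from data before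
    \<open>t\<close>.\<close>
  have X: "X s \<in> borel_measurable ?L" if "s \<le> t" for s
  proof (cases "s < t")
    case False
    show ?thesis
    proof (cases s)
      case 0
      then show ?thesis
        using less.prems by (auto intro: measurable_sources)
    next
      case (Suc r)
      then have r: "r < t" using that by simp
      have "(\<lambda>w. A *v X r w + B *v U r w + W r w) \<in> borel_measurable ?L"
        using IH(3)[OF r] U[OF r] less.prems(2)
        by (intro borel_measurable_add measurable_matrix_vector_mult measurable_sources)
      then show ?thesis
        unfolding Suc by (subst measurable_cong[OF plant]) auto
    qed
  qed (rule IH(3))
  have "(\<lambda>w. (\<lambda>s\<in>{0..t}. X s w, \<lambda>s\<in>{0..<t}. U s w)) \<in>
      ?L \<rightarrow>\<^sub>M PiM {0..t} (\<lambda>_. borel) \<Otimes>\<^sub>M PiM {0..<t} (\<lambda>_. borel)"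
    by (intro measurable_Pair measurable_restrict) (auto intro: X U)
  from measurable_compose[OF this f_meas[of t]]
  have "(\<lambda>w. if odd t then f t (\<lambda>s\<in>{0..t}. X s w, \<lambda>s\<in>{0..<t}. U s w) else 0) \<in> borel_measurable ?L"
    by (cases "odd t") auto
  then have Se: "Se t \<in> borel_measurable ?L"
    by (subst measurable_cong[OF encoder]) auto
  have Sr: "Sr i t \<in> borel_measurable ?L" for i
  proof -
    have "(\<lambda>w. \<lambda>s\<in>{0..<t}. Y i s w) \<in> ?L \<rightarrow>\<^sub>M PiM {0..<t} (\<lambda>_. borel)"
      by (intro measurable_restrict) (auto intro: Y)
    from measurable_compose[OF this g_meas[of i t]]
    have "(\<lambda>w. if even t \<and> 0 < t then g i t (\<lambda>s\<in>{0..<t}. Y i s w) else 0) \<in> borel_measurable ?L"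
      by (cases "even t \<and> 0 < t") auto
    then show ?thesis
      by (subst measurable_cong[OF relay_out]) auto
  qed
  show ?case
    using Se Sr X Y R by auto
qed

text \<open>The received signals \<open>\<rho>\<close> are arbitrary here, not those of the closed loop, so that they can be
  frozen while the initial state is integrated out.\<close>

definition control_drift :: "('l \<Rightarrow> nat \<Rightarrow> real) \<Rightarrow> (nat \<Rightarrow> real^'n) \<Rightarrow> nat \<Rightarrow> real^'n" where
  "control_drift \<rho> v = drift A (\<lambda>t. B *v \<pi> t (\<lambda>(i, s)\<in>UNIV \<times> {0..t}. \<rho> i s) + v t)"

lemma control_drift_cong:
  assumes "\<And>i s. s < t \<Longrightarrow> \<rho> i s = \<rho>' i s"
  shows "control_drift \<rho> v t = control_drift \<rho>' v t"
  unfolding control_drift_def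
proof (rule drift_cong)
  fix s assume "s < t"
  then have "(\<lambda>(i, r)\<in>UNIV \<times> {0..s}. \<rho> i r) = (\<lambda>(i, r)\<in>UNIV \<times> {0..s}. \<rho>' i r)"
    using assms by (auto simp: fun_eq_iff restrict_def)
  then show "B *v \<pi> s (\<lambda>(i, r)\<in>UNIV \<times> {0..s}. \<rho> i r) + v s = B *v \<pi> s (\<lambda>(i, r)\<in>UNIV \<times> {0..s}. \<rho>' i r) + v s"
    by simp
qed

lemma measurable_control_drift:
  assumes "\<And>i s. (\<lambda>x. \<rho> x i s) \<in> borel_measurable L" "\<And>s. (\<lambda>x. v x s) \<in> borel_measurable L"
  shows "(\<lambda>x. control_drift (\<rho> x) (v x) t) \<in> borel_measurable L"
  unfolding control_drift_def
proof (intro measurable_drift borel_measurable_add measurable_matrix_vector_mult assms(2))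
  fix s
  have "(\<lambda>x. \<lambda>(i, r)\<in>UNIV \<times> {0..s}. \<rho> x i r) \<in> L \<rightarrow>\<^sub>M PiM (UNIV \<times> {0..s}) (\<lambda>_. borel)"
    using assms(1) by (intro measurable_restrict) (auto split: prod.split)
  from measurable_compose[OF this \<pi>_meas[of s]]
  show "(\<lambda>x. \<pi> s (\<lambda>(i, r)\<in>UNIV \<times> {0..s}. \<rho> x i r)) \<in> borel_measurable L" .
qed

text \<open>Variation of constants for the plant, with the controls computed from the received
  signals.\<close>

lemma state_eq:
  assumes "w \<in> space M"
  shows "X t w = ((*v) A ^^ t) (X 0 w) + control_drift (\<lambda>i s. R i s w) (\<lambda>s. W s w) t"
proof (induction t)
  case (Suc t)
  then show ?case
    using assms by (simp add: plant controller control_drift_def matrix_vector_right_distrib)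
qed (simp add: control_drift_def)

lemma initial_density:
  obtains p where "distributed M lborel (X 0) (\<lambda>x. ennreal (p x))" "p \<in> borel_measurable borel"
    "\<And>x. 0 \<le> p x" "integrable lborel (\<lambda>x. p x * ln (p x))"
proof -
  interpret information_space M 2
    by standard simp
  obtain p where p: "finite_entropy lborel (X 0) p"
    using X0_entropy by (auto simp: finite_differential_entropy_def)
  have "integrable lborel (\<lambda>x. ln 2 * (p x * log 2 (p x)))"
    using finite_entropy_integrable[OF p] by simp
  then have "integrable lborel (\<lambda>x. p x * ln (p x))"
    by (simp add: log_def)
  then show ?thesis
    using finite_entropy_distributed[OF p] finite_entropy_measurable[OF p] finite_entropy_nn[OF p]
    by (intro that[of p]) auto
qed

lemma measurable_state: "X t \<in> borel_measurable M"
proof -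
  \<comment> \<open>The constant is a dummy: what is wanted is the measurability of the identity out
    of \<open>M\<close>, which \<open>indep_of\<close> contains.\<close>
  have "indep_of (source_algebra UNIV) (\<lambda>_. 0::real)"
    by (rule indep_of_source_algebra[where J="{}"]) auto
  from measurable_compose[OF indep_of_measurable(1)[OF this], of "X t" borel] measurable_signals[of UNIV t]
  show ?thesis by auto
qed

lemma indep_vars_source:
  assumes "inj h" "\<And>i. source_events (h i) = generated_events M (Z i)"
    "\<And>i. Z i \<in> borel_measurable M"
  shows "indep_vars (\<lambda>_. borel) Z UNIV"
  using indep_sets_reindex[OF indep_source_events assms(1)] assms(2,3)
  by (simp add: indep_vars_def2 generated_events_def)

lemma indep_vars_noise:
  "indep_vars (\<lambda>_. borel) (\<lambda>i. Zr i t) UNIV" "indep_vars (\<lambda>_. borel) (\<lambda>i. Zd i t) UNIV"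
proof -
  have [simp]: "Zr i t \<in> borel_measurable M" "Zd i t \<in> borel_measurable M" for i
    using Zr_gauss[of i t] Zd_gauss[of i t] by (auto simp: distributed_def)
  show "indep_vars (\<lambda>_. borel) (\<lambda>i. Zr i t) UNIV"
    by (rule indep_vars_source[of "\<lambda>i. Relay_noise i t"]) (auto simp: inj_def source_events_def)
  show "indep_vars (\<lambda>_. borel) (\<lambda>i. Zd i t) UNIV"
    by (rule indep_vars_source[of "\<lambda>i. Dest_noise i t"]) (auto simp: inj_def source_events_def)
qed

section \<open>The bound from each hop\<close>

lemma prod_normal_pos:
  "(\<And>i. 0 < \<sigma> i) \<Longrightarrow> 0 < (\<Prod>i\<in>UNIV. normal_density 0 (\<sigma> i) (z $ i))" for z :: "real^'l"
  by (intro prod_pos ballI normal_density_pos)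

lemma P_S_nonneg: "0 \<le> P_S"
  using power_S[of 1] Bochner_Integration.integral_nonneg[of M "\<lambda>w. (Se 1 w)\<^sup>2"] by (simp add: has_bochner_integral_iff)

lemma P_used_nonneg: "0 \<le> P_used i"
  using power_r[of 2 i] Bochner_Integration.integral_nonneg[of M "\<lambda>w. (Sr i 2 w)\<^sup>2"] by (simp add: has_bochner_integral_iff)

text \<open>The controls are functions of the received signals, so given these and the plant noise,
  the initial state enters the state through the free motion only. Use \<open>k\<close> takes place
  at time \<open>2 * k + 2\<close>; two plant steps per use give the factor 2.\<close>

lemma second_hop_bound:
  assumes det: "det A \<noteq> 0"
  shows "2 * ln \<bar>det A\<bar> \<le> (\<Sum>i\<in>UNIV. 1 / 2 * ln (1 + 2 * P_used i / Nd i))"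
proof -
  define J where "J k = range (\<lambda>i::'l. Dest_noise i (2 * k + 2))" for k :: nat
  \<comment> \<open>Taking all other sources, later ones included, makes independence of the noise
    of use \<open>k\<close> immediate; by causality the input of that use is still
    measurable.\<close>
  define N where "N k = source_algebra (- J k)" for k
  define N0 where "N0 = source_algebra (range Plant)"
  define V where "V k \<omega> = (\<chi> i. Zd i (2 * k + 2) \<omega>)" for k \<omega>
  define s where "s k \<omega> = (\<chi> i. Sr i (2 * k + 2) \<omega>)" for k \<omega>
  define r where "r k \<omega> = (\<chi> i. R i (2 * k + 2) \<omega>)" for k \<omega>
  define \<phi> where "\<phi> z = (\<Prod>i\<in>UNIV. normal_density 0 (sqrt (Nd i)) (z $ i))" for z :: "real^'l"
  define q where "q z = (\<Prod>i\<in>UNIV. normal_density 0 (sqrt (Nd i + 2 * P_used i)) (z $ i))" for z :: "real^'l"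
  \<comment> \<open>Rebuilds the received signals from a path of channel outputs: use
    \<open>t div 2 - 1\<close> at even \<open>t > 0\<close>, and 0 at the idle times.\<close>
  define \<rho> where "\<rho> x i t = (if even t \<and> 0 < t then x (t div 2 - 1) $ i else 0)" for x :: "nat \<Rightarrow> real^'l" and i t
  define c where "c K = (\<lambda>(\<omega>, x). control_drift (\<rho> x) (\<lambda>t. W t \<omega>) (2 * K))" for K
  obtain p where p: "distributed M lborel (X 0) (\<lambda>x. ennreal (p x))" "p \<in> borel_measurable borel"
    "\<And>x. 0 \<le> p x" "integrable lborel (\<lambda>x. p x * ln (p x))"
    by (rule initial_density) blast
  obtain m where m: "\<And>t. (\<integral>\<^sup>+w. ennreal ((norm (X t w))\<^sup>2) \<partial>M) < ennreal m"
    using stable by (auto simp: mean_square_stable_def)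
  have P_nn: "0 \<le> 2 * P_used i" for i
    using P_used_nonneg by simp
  have Npos: "0 < Nd i + 2 * P_used i" for i
    using Nd_pos[of i] P_nn[of i] by linarith
  have V_meas: "V k \<in> borel_measurable (source_algebra (J k))" for k
    unfolding V_def by (intro measurable_vec_lambda measurable_sources) (auto simp: J_def)
  have indep_V: "indep_of (N k) (V k)" for k
    unfolding N_def by (rule indep_of_source_algebra[OF _ V_meas]) auto
  have V_dist: "distributed M lborel (V k) (\<lambda>z. ennreal (\<phi> z))" for k
    unfolding V_def \<phi>_def by (intro distributed_vec indep_vars_noise Zd_gauss) auto
  have signals: "Sr i (2 * k + 2) \<in> borel_measurable (N k)"
    "t < 2 * k + 2 \<Longrightarrow> R i t \<in> borel_measurable (N k)" for i k t
    using measurable_signals[of "- J k" "2 * k + 2"] by (auto simp: N_def J_def)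
  have s_meas: "s k \<in> borel_measurable (N k)" for k
    unfolding s_def by (intro measurable_vec_lambda signals)
  have past: "r j \<in> borel_measurable (N k)" "V j \<in> borel_measurable (N k)" if "j < k" for j k
  proof -
    show "r j \<in> borel_measurable (N k)"
      unfolding r_def using that by (intro measurable_vec_lambda signals) simp
    show "V j \<in> borel_measurable (N k)"
      unfolding V_def N_def using that by (intro measurable_vec_lambda measurable_sources) (auto simp: J_def)
  qed
  have r_eq: "r k \<omega> = s k \<omega> + V k \<omega>" if "\<omega> \<in> space M" for k \<omega>
    using that by (simp add: r_def s_def V_def vec_eq_iff received)
  have rate: "has_bochner_integral M (\<lambda>\<omega>. ln (q (r k \<omega>) / \<phi> (V k \<omega>)))
      (- (\<Sum>i\<in>UNIV. 1 / 2 * ln (1 + 2 * P_used i / Nd i)))" for k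
  proof -
    have sV: "indep_var borel (\<lambda>\<omega>. s k \<omega> $ i) borel (\<lambda>\<omega>. V k \<omega> $ i)" for i
      using indep_of_imp_indep_var[OF indep_V, of "\<lambda>\<omega>. s k \<omega> $ i" k borel "\<lambda>z. z $ i"]
        measurable_vec_nth_compose[OF s_meas] by simp
    have V2: "has_bochner_integral M (\<lambda>\<omega>. (V k \<omega> $ i)\<^sup>2) (Nd i)" "has_bochner_integral M (\<lambda>\<omega>. V k \<omega> $ i) 0" for i
      using normal_second_moment[OF Nd_pos Zd_gauss] by (simp_all add: V_def)
    have s2: "has_bochner_integral M (\<lambda>\<omega>. (s k \<omega> $ i)\<^sup>2) (2 * P_used i)" for i
      using power_r[of "2 * k + 2" i] by (simp add: s_def)
    have "has_bochner_integral M (\<lambda>\<omega>. ln (q (s k \<omega> + V k \<omega>) / \<phi> (V k \<omega>)))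
        (- (\<Sum>i\<in>UNIV. 1 / 2 * ln (1 + 2 * P_used i / Nd i)))"
      unfolding q_def \<phi>_def
      by (rule gaussian_vector_rate[OF Nd_pos P_nn s2 V2(1) has_bochner_integral_mult_indep_zero[OF sV s2 V2(2)]])
    then show ?thesis
      by (rule has_bochner_integral_cong[THEN iffD1, rotated -1]) (auto simp: r_eq)
  qed
  have X: "X (2 * K) \<omega> = ((*v) A ^^ (2 * K)) (X 0 \<omega>) + c K (\<omega>, \<lambda>k. if k < K then r k \<omega> else 0)"
    if "\<omega> \<in> space M" for K \<omega>
  proof -
    have "control_drift (\<lambda>i s. R i s \<omega>) (\<lambda>s. W s \<omega>) (2 * K)
        = control_drift (\<rho> (\<lambda>k. if k < K then r k \<omega> else 0)) (\<lambda>s. W s \<omega>) (2 * K)"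
    proof (rule control_drift_cong)
      fix i t assume "t < 2 * K"
      show "R i t \<omega> = \<rho> (\<lambda>k. if k < K then r k \<omega> else 0) i t"
      proof (cases "even t \<and> 0 < t")
        case True
        then have "t = 2 * (t div 2 - 1) + 2"
          by (auto elim!: evenE)
        then obtain j where "t = 2 * j + 2" ..
        with \<open>t < 2 * K\<close> show ?thesis
          by (simp add: \<rho>_def r_def)
      next
        case False
        then show ?thesis
          using that by (auto simp: \<rho>_def received)
      qed
    qed
    then show ?thesis
      using state_eq[OF that, of "2 * K"] by (simp add: c_def)
  qed
  have c_meas: "c K \<in> borel_measurable (N0 \<Otimes>\<^sub>M PiM UNIV (\<lambda>_. borel))" for K
  proof -
    have "(\<lambda>x. \<rho> (snd x) i t) \<in> borel_measurable (N0 \<Otimes>\<^sub>M PiM UNIV (\<lambda>_. borel))" for i t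
      unfolding \<rho>_def
      by (cases "even t \<and> 0 < t") (auto intro!: measurable_vec_nth_compose measurable_compose[OF measurable_snd])
    moreover have "(\<lambda>x. W t (fst x)) \<in> borel_measurable (N0 \<Otimes>\<^sub>M PiM UNIV (\<lambda>_. borel :: (real^'l) measure))" for t
      by (rule measurable_compose[OF measurable_fst]) (auto simp: N0_def intro: measurable_sources)
    ultimately show ?thesis
      unfolding c_def case_prod_unfold
      by (rule measurable_control_drift[where \<rho>="\<lambda>x. \<rho> (snd x)" and v="\<lambda>x t. W t (fst x)"])
  qed
  have q_pos: "0 < q x" for x
    unfolding q_def by (rule prod_normal_pos) (use Npos in auto)
  have \<phi>_pos: "0 < \<phi> x" for x
    unfolding \<phi>_def by (rule prod_normal_pos) (use Nd_pos in auto)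
  have "(\<integral>\<^sup>+x. ennreal (q x) \<partial>lborel) = 1"
    unfolding q_def using Npos by (subst nn_integral_prod_vec) (auto simp: nn_integral_normal_density)
  then have q_le: "(\<integral>\<^sup>+x. ennreal (q x) \<partial>lborel) \<le> 1"
    by simp
  have "indep_of N0 (X 0)"
    unfolding N0_def by (rule indep_of_source_algebra[where J="{Initial}"]) (auto intro: measurable_sources)
  moreover have "(\<lambda>\<omega>. \<omega>) \<in> N k \<rightarrow>\<^sub>M N0" "X 0 \<in> borel_measurable (N k)" for k
    unfolding N_def N0_def by (auto intro!: source_algebra_mono measurable_sources simp: J_def)
  ultimately show ?thesis
    using log_det_le_information_rate[where N=N and V=V and \<phi>=\<phi> and q=q and R=r and s=s and \<xi>="X 0" and p=p
        and NO=N0 and c=c and X="\<lambda>K. X (2 * K)" and A=A and m=m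
        and I="\<Sum>i\<in>UNIV. 1 / 2 * ln (1 + 2 * P_used i / Nd i)",
        OF indep_V V_dist _ \<phi>_pos _ q_pos q_le r_eq s_meas past _ _ p _ _ _ c_meas X measurable_state m det]
      rate
    by (auto simp: has_bochner_integral_iff \<phi>_def[abs_def] q_def[abs_def])
qed

text \<open>Relay outputs are functions of relay inputs, so given the latter and the plant and
  destination noises, the whole control sequence is known. One use is a single symbol heard by all
  relays, hence the reference density \<open>simo_density\<close>.\<close>

lemma first_hop_bound:
  assumes det: "det A \<noteq> 0"
  shows "2 * ln \<bar>det A\<bar> \<le> 1 / 2 * ln (1 + 2 * P_S * (\<Sum>i\<in>UNIV. 1 / Nr i))"
proof -
  define J where "J k = range (\<lambda>i::'l. Relay_noise i (2 * k + 1))" for k :: nat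
  define N where "N k = source_algebra (- J k)" for k
  \<comment> \<open>Destination noise counts as side information here; it is independent of the
    initial state and of the relay noise.\<close>
  define I0 where "I0 = range Plant \<union> range (\<lambda>(i::'l, t). Dest_noise i t)"
  define N0 where "N0 = source_algebra I0"
  define V where "V k \<omega> = (\<chi> i. Zr i (2 * k + 1) \<omega>)" for k \<omega>
  define s where "s k \<omega> = (\<chi> i::'l. Se (2 * k + 1) \<omega>)" for k \<omega>
  define r where "r k \<omega> = (\<chi> i. Y i (2 * k + 1) \<omega>)" for k \<omega>
  define \<phi> where "\<phi> z = (\<Prod>i\<in>UNIV. normal_density 0 (sqrt (Nr i)) (z $ i))" for z :: "real^'l"
  define q where "q = simo_density Nr (2 * P_S)"
  \<comment> \<open>Replays the relays and the second hop from a path \<open>y\<close> of relay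
    inputs: odd time \<open>s\<close> is use \<open>s div 2\<close>, and even times carry 0.\<close>
  define \<rho> where "\<rho> \<omega> y i t = (if even t \<and> 0 < t
      then g i t (\<lambda>s\<in>{0..<t}. if odd s then y (s div 2) $ i else 0) + Zd i t \<omega> else 0)"
    for \<omega> and y :: "nat \<Rightarrow> real^'l" and i t
  define c where "c K = (\<lambda>(\<omega>, y). control_drift (\<rho> \<omega> y) (\<lambda>t. W t \<omega>) (2 * K))" for K
  obtain p where p: "distributed M lborel (X 0) (\<lambda>x. ennreal (p x))" "p \<in> borel_measurable borel"
    "\<And>x. 0 \<le> p x" "integrable lborel (\<lambda>x. p x * ln (p x))"
    by (rule initial_density) blast
  obtain m where m: "\<And>t. (\<integral>\<^sup>+w. ennreal ((norm (X t w))\<^sup>2) \<partial>M) < ennreal m"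
    using stable by (auto simp: mean_square_stable_def)
  have sum_nn: "0 \<le> (\<Sum>i\<in>UNIV. 1 / Nr i)"
    using Nr_pos by (intro sum_nonneg) (auto simp: less_imp_le)
  then have pos: "0 < 1 + 2 * P_S * (\<Sum>i\<in>UNIV. 1 / Nr i)"
    using P_S_nonneg by (intro add_pos_nonneg) auto
  have V_meas: "V k \<in> borel_measurable (source_algebra (J k))" for k
    unfolding V_def by (intro measurable_vec_lambda measurable_sources) (auto simp: J_def)
  have indep_V: "indep_of (N k) (V k)" for k
    unfolding N_def by (rule indep_of_source_algebra[OF _ V_meas]) auto
  have V_dist: "distributed M lborel (V k) (\<lambda>z. ennreal (\<phi> z))" for k
    unfolding V_def \<phi>_def by (intro distributed_vec indep_vars_noise Zr_gauss) auto
  have signals: "Se (2 * k + 1) \<in> borel_measurable (N k)"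
    "t < 2 * k + 1 \<Longrightarrow> Y i t \<in> borel_measurable (N k)" for i k t
    using measurable_signals[of "- J k" "2 * k + 1"] by (auto simp: N_def J_def)
  have s_meas: "s k \<in> borel_measurable (N k)" for k
    unfolding s_def by (intro measurable_vec_lambda signals)
  have past: "r j \<in> borel_measurable (N k)" "V j \<in> borel_measurable (N k)" if "j < k" for j k
  proof -
    show "r j \<in> borel_measurable (N k)"
      unfolding r_def using that by (intro measurable_vec_lambda signals) simp
    show "V j \<in> borel_measurable (N k)"
      unfolding V_def N_def using that by (intro measurable_vec_lambda measurable_sources) (auto simp: J_def)
  qed
  have r_eq: "r k \<omega> = s k \<omega> + V k \<omega>" if "\<omega> \<in> space M" for k \<omega>
    using that by (simp add: r_def s_def V_def vec_eq_iff relay_in)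
  have G_dist: "distributed M lborel (\<lambda>\<omega>. \<Sum>i\<in>UNIV. V k \<omega> $ i / Nr i)
      (normal_density 0 (sqrt (\<Sum>i\<in>UNIV. 1 / Nr i)))" for k
    unfolding V_def using normal_weighted_sum[OF Nr_pos indep_vars_noise(1) Zr_gauss] by simp
  have rate: "has_bochner_integral M (\<lambda>\<omega>. ln (q (r k \<omega>) / \<phi> (V k \<omega>)))
      (- (1 / 2 * ln (1 + 2 * P_S * (\<Sum>i\<in>UNIV. 1 / Nr i))))" for k
  proof -
    have SG: "indep_var borel (Se (2 * k + 1)) borel (\<lambda>\<omega>. \<Sum>i\<in>UNIV. V k \<omega> $ i / Nr i)"
      by (rule indep_of_imp_indep_var[OF indep_V signals(1)]) measurable
    have "0 < (\<Sum>i\<in>UNIV. 1 / Nr i)"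
      using Nr_pos by (intro sum_pos) auto
    note G2 = normal_second_moment[OF this G_dist[of k]]
    have S2: "has_bochner_integral M (\<lambda>\<omega>. (Se (2 * k + 1) \<omega>)\<^sup>2) (2 * P_S)"
      by (rule power_S) simp
    have "has_bochner_integral M (\<lambda>\<omega>. ln (q (s k \<omega> + V k \<omega>) / \<phi> (V k \<omega>)))
        (- (1 / 2 * ln (1 + 2 * P_S * (\<Sum>i\<in>UNIV. 1 / Nr i))))"
      unfolding q_def \<phi>_def s_def
      by (rule simo_rate[OF Nr_pos _ S2 G2(1) has_bochner_integral_mult_indep_zero[OF SG S2 G2(2)]])
        (use P_S_nonneg in simp)
    then show ?thesis
      by (rule has_bochner_integral_cong[THEN iffD1, rotated -1]) (auto simp: r_eq)
  qed
  have X: "X (2 * K) \<omega> = ((*v) A ^^ (2 * K)) (X 0 \<omega>) + c K (\<omega>, \<lambda>k. if k < K then r k \<omega> else 0)"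
    if "\<omega> \<in> space M" for K \<omega>
  proof -
    have "control_drift (\<lambda>i s. R i s \<omega>) (\<lambda>s. W s \<omega>) (2 * K)
        = control_drift (\<rho> \<omega> (\<lambda>k. if k < K then r k \<omega> else 0)) (\<lambda>s. W s \<omega>) (2 * K)"
    proof (rule control_drift_cong)
      fix i t assume t: "t < 2 * K"
      have "(\<lambda>s\<in>{0..<t}. Y i s \<omega>)
          = (\<lambda>s\<in>{0..<t}. if odd s then (if s div 2 < K then r (s div 2) \<omega> else 0) $ i else 0)"
      proof (rule restrict_ext)
        fix s assume s: "s \<in> {0..<t}"
        show "Y i s \<omega> = (if odd s then (if s div 2 < K then r (s div 2) \<omega> else 0) $ i else 0)"
        proof (cases "odd s")
          case True
          then obtain j where "s = 2 * j + 1"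
            by (rule oddE)
          with s t show ?thesis
            by (simp add: r_def)
        next
          case False
          then show ?thesis
            using that by (simp add: relay_in)
        qed
      qed
      then show "R i t \<omega> = \<rho> \<omega> (\<lambda>k. if k < K then r k \<omega> else 0) i t"
        using that by (simp add: \<rho>_def received relay_out)
    qed
    then show ?thesis
      using state_eq[OF that, of "2 * K"] by (simp add: c_def)
  qed
  have c_meas: "c K \<in> borel_measurable (N0 \<Otimes>\<^sub>M PiM UNIV (\<lambda>_. borel))" for K
  proof -
    let ?L = "N0 \<Otimes>\<^sub>M PiM UNIV (\<lambda>_::nat. borel :: (real^'l) measure)"
    have "(\<lambda>x. \<rho> (fst x) (snd x) i t) \<in> borel_measurable ?L" for i t
    proof (cases "even t \<and> 0 < t")
      case True
      have "(\<lambda>x. if odd s then snd x (s div 2) $ i else 0) \<in> borel_measurable ?L" for s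
        by (cases "odd s") (auto intro!: measurable_vec_nth_compose measurable_compose[OF measurable_snd])
      then have "(\<lambda>x. \<lambda>s\<in>{0..<t}. if odd s then snd x (s div 2) $ i else 0) \<in> ?L \<rightarrow>\<^sub>M PiM {0..<t} (\<lambda>_. borel)"
        by (rule measurable_restrict)
      from measurable_compose[OF this g_meas[of i t]]
      have "(\<lambda>x. g i t (\<lambda>s\<in>{0..<t}. if odd s then snd x (s div 2) $ i else 0)) \<in> borel_measurable ?L" .
      moreover have "Zd i t \<in> borel_measurable N0"
        unfolding N0_def by (rule measurable_sources) (auto simp: I0_def)
      then have "(\<lambda>x. Zd i t (fst x)) \<in> borel_measurable ?L"
        by (rule measurable_compose[OF measurable_fst])
      ultimately show ?thesis
        using True by (simp add: \<rho>_def)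
    next
      case False
      then have "(\<lambda>x. \<rho> (fst x) (snd x) i t) = (\<lambda>x. 0)"
        by (auto simp: \<rho>_def)
      then show ?thesis by simp
    qed
    moreover have "(\<lambda>x. W t (fst x)) \<in> borel_measurable ?L" for t
      by (rule measurable_compose[OF measurable_fst]) (auto simp: N0_def I0_def intro: measurable_sources)
    ultimately show ?thesis
      unfolding c_def case_prod_unfold
      by (rule measurable_control_drift[where \<rho>="\<lambda>x. \<rho> (fst x) (snd x)" and v="\<lambda>x t. W t (fst x)"])
  qed
  have \<phi>_pos: "0 < \<phi> x" for x
    unfolding \<phi>_def by (rule prod_normal_pos) (use Nr_pos in auto)
  have q_pos: "0 < q x" for x
    unfolding q_def simo_density_def
    using pos \<phi>_pos[of x] by (intro mult_pos_pos divide_pos_pos) (auto simp: \<phi>_def)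
  have q_meas: "q \<in> borel_measurable borel"
    unfolding q_def simo_density_def[abs_def] by measurable
  have "(\<integral>\<^sup>+x. ennreal (q x) \<partial>lborel) = 1"
    unfolding q_def using V_dist[of 0] P_S_nonneg
    by (intro nn_integral_simo_density[OF Nr_pos _ _ G_dist[of 0]]) (auto simp: \<phi>_def)
  then have q_le: "(\<integral>\<^sup>+x. ennreal (q x) \<partial>lborel) \<le> 1"
    by simp
  have "indep_of N0 (X 0)"
    unfolding N0_def I0_def
    by (rule indep_of_source_algebra[where J="{Initial}"]) (auto intro: measurable_sources)
  moreover have "(\<lambda>\<omega>. \<omega>) \<in> N k \<rightarrow>\<^sub>M N0" "X 0 \<in> borel_measurable (N k)" for k
    unfolding N_def N0_def I0_def by (auto intro!: source_algebra_mono measurable_sources simp: J_def)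
  ultimately show ?thesis
    using log_det_le_information_rate[where N=N and V=V and \<phi>=\<phi> and q=q and R=r and s=s and \<xi>="X 0" and p=p
        and NO=N0 and c=c and X="\<lambda>K. X (2 * K)" and A=A and m=m
        and I="1 / 2 * ln (1 + 2 * P_S * (\<Sum>i\<in>UNIV. 1 / Nr i))",
        OF indep_V V_dist _ \<phi>_pos q_meas q_pos q_le r_eq s_meas past _ _ p _ _ _ c_meas X measurable_state m det]
      rate
    by (auto simp: has_bochner_integral_iff \<phi>_def[abs_def])
qed

end

text \<open>The tangent of the logarithm at the water-filling powers has slope at most \<open>1 / \<gamma>\<close>, with
  equality on the active channels.\<close>

lemma water_filling_optimal:
  fixes N P Q :: "'l::finite \<Rightarrow> real"
  assumes N: "\<And>i. 0 < N i" and P: "\<And>i. 0 \<le> P i"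
    and Q: "\<And>i. Q i = max (\<gamma> - N i / 2) 0" and le: "(\<Sum>i\<in>UNIV. P i) \<le> (\<Sum>i\<in>UNIV. Q i)"
  shows "(\<Sum>i\<in>UNIV. ln (1 + 2 * P i / N i)) \<le> (\<Sum>i\<in>UNIV. ln (1 + 2 * Q i / N i))"
proof (cases "0 < \<gamma>")
  case True
  have "ln (1 + 2 * P i / N i) - ln (1 + 2 * Q i / N i) \<le> (P i - Q i) / \<gamma>" for i
  proof -
    have "0 \<le> Q i"
      by (simp add: Q)
    then have pos: "0 < N i + 2 * P i" "0 < N i + 2 * Q i"
      using N[of i] P[of i] by linarith+
    have "1 + 2 * P i / N i = (N i + 2 * P i) / N i" "1 + 2 * Q i / N i = (N i + 2 * Q i) / N i"
      using N[of i] by (auto simp: field_simps)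
    then have "ln (1 + 2 * P i / N i) - ln (1 + 2 * Q i / N i) = ln ((N i + 2 * P i) / (N i + 2 * Q i))"
      using N[of i] pos by (simp add: ln_div)
    also have "\<dots> \<le> (N i + 2 * P i) / (N i + 2 * Q i) - 1"
      using pos by (intro ln_le_minus_one) simp
    also have "\<dots> = 2 * (P i - Q i) / (N i + 2 * Q i)"
      using pos by (simp add: field_simps)
    also have "\<dots> \<le> (P i - Q i) / \<gamma>"
    proof (cases "N i / 2 \<le> \<gamma>")
      case True
      then have "N i + 2 * Q i = 2 * \<gamma>"
        by (simp add: Q)
      then show ?thesis
        by (simp add: diff_divide_distrib)
    next
      \<comment> \<open>The slope may be strictly below \<open>1 / \<gamma>\<close> here, which is
        harmless because \<open>P i - Q i = P i\<close> is nonnegative.\<close>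
      case False
      then have "Q i = 0" "2 * \<gamma> \<le> N i"
        by (simp_all add: Q)
      with \<open>0 < \<gamma>\<close> P[of i] have "2 * P i / N i \<le> 2 * P i / (2 * \<gamma>)"
        by (intro divide_left_mono) auto
      with \<open>Q i = 0\<close> show ?thesis by simp
    qed
    finally show ?thesis .
  qed
  then have "(\<Sum>i\<in>UNIV. ln (1 + 2 * P i / N i) - ln (1 + 2 * Q i / N i)) \<le> (\<Sum>i\<in>UNIV. (P i - Q i) / \<gamma>)"
    by (rule sum_mono)
  also have "\<dots> = ((\<Sum>i\<in>UNIV. P i) - (\<Sum>i\<in>UNIV. Q i)) / \<gamma>"
    by (simp add: sum_subtractf sum_divide_distrib diff_divide_distrib)
  also have "\<dots> \<le> 0"
    using le True by (intro divide_nonpos_pos) auto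
  finally show ?thesis
    by (simp add: sum_subtractf)
next
  case False
  \<comment> \<open>A nonpositive water level fills no channel, so the budget forces all powers to
    vanish.\<close>
  have Q0: "Q i = 0" for i
    using False N[of i] by (simp add: Q)
  then have "(\<Sum>i\<in>UNIV. P i) = 0"
    using le P by (intro antisym sum_nonneg) auto
  then have "P i = 0" for i
    using P by (simp add: sum_nonneg_eq_0_iff)
  with Q0 show ?thesis by simp
qed

theorem theorem4p1:
  fixes M :: "'a measure"
    and A :: "real^'n^'n" and B :: "real^'m^'n"
    and \<Lambda>0 K_W :: "real^'n^'n"
    and X :: "nat \<Rightarrow> 'a \<Rightarrow> real^'n" and U :: "nat \<Rightarrow> 'a \<Rightarrow> real^'m"
    and W :: "nat \<Rightarrow> 'a \<Rightarrow> real^'n"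
    and Se :: "nat \<Rightarrow> 'a \<Rightarrow> real"
    and Y Sr R Zr Zd :: "'l::finite \<Rightarrow> nat \<Rightarrow> 'a \<Rightarrow> real"
    and f :: "nat \<Rightarrow> (nat \<Rightarrow> real^'n) \<times> (nat \<Rightarrow> real^'m) \<Rightarrow> real"
    and g :: "'l \<Rightarrow> nat \<Rightarrow> (nat \<Rightarrow> real) \<Rightarrow> real"
    and \<pi> :: "nat \<Rightarrow> ('l \<times> nat \<Rightarrow> real) \<Rightarrow> real^'m"
    and P_S P_R \<gamma> :: real
    and Nr Nd P_used P_opt :: "'l \<Rightarrow> real"
  assumes prob: "prob_space M"
    \<comment> \<open>plant\<close>
    and ctrl: "controllable A B"
    and unstable: "\<And>z. complex_eigenvalue A z \<Longrightarrow> 1 \<le> cmod z"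
    and X0_entropy: "finite_differential_entropy M (X 0)"
    and X0_cov: "has_covariance M (X 0) \<Lambda>0"
    and W_gauss: "\<And>t. zero_mean_gaussian_vector M (W t)"
    and W_cov: "\<And>t. has_covariance M (W t) K_W"
    and plant: "\<And>t w. w \<in> space M \<Longrightarrow> X (Suc t) w = A *v X t w + B *v U t w + W t w"
    \<comment> \<open>channel noises\<close>
    and Nr_pos: "\<And>i. 0 < Nr i"
    and Nd_pos: "\<And>i. 0 < Nd i"
    and Zr_gauss: "\<And>i t. distributed M lborel (Zr i t) (normal_density 0 (sqrt (Nr i)))"
    and Zd_gauss: "\<And>i t. distributed M lborel (Zd i t) (normal_density 0 (sqrt (Nd i)))"
    and indep: "independent_sources M (X 0) W Zr Zd"
    \<comment> \<open>encoder, relay and controller policies\<close>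
    and f_meas: "\<And>t. f t \<in> borel_measurable
                   (PiM {0..t} (\<lambda>_. borel) \<Otimes>\<^sub>M PiM {0..<t} (\<lambda>_. borel))"
    and g_meas: "\<And>i t. g i t \<in> borel_measurable (PiM {0..<t} (\<lambda>_. borel))"
    and \<pi>_meas: "\<And>t. \<pi> t \<in> borel_measurable (PiM (UNIV \<times> {0..t}) (\<lambda>_. borel))"
    \<comment> \<open>half-duplex parallel network\<close>
    and encoder: "\<And>t w. w \<in> space M \<Longrightarrow> Se t w =
        (if odd t then f t (\<lambda>s\<in>{0..t}. X s w, \<lambda>s\<in>{0..<t}. U s w) else 0)"
    and relay_in: "\<And>i t w. w \<in> space M \<Longrightarrow> Y i t w =
        (if odd t then Se t w + Zr i t w else 0)"
    and relay_out: "\<And>i t w. w \<in> space M \<Longrightarrow> Sr i t w =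
        (if even t \<and> 0 < t then g i t (\<lambda>s\<in>{0..<t}. Y i s w) else 0)"
    and received: "\<And>i t w. w \<in> space M \<Longrightarrow> R i t w =
        (if even t \<and> 0 < t then Sr i t w + Zd i t w else 0)"
    and controller: "\<And>t w. w \<in> space M \<Longrightarrow>
        U t w = \<pi> t (\<lambda>(i, s)\<in>UNIV \<times> {0..t}. R i s w)"
    \<comment> \<open>power constraints\<close>
    and power_S: "\<And>t. odd t \<Longrightarrow> has_bochner_integral M (\<lambda>w. (Se t w)\<^sup>2) (2 * P_S)"
    and power_r: "\<And>i t. even t \<Longrightarrow> 0 < t \<Longrightarrow>
        has_bochner_integral M (\<lambda>w. (Sr i t w)\<^sup>2) (2 * P_used i)"
    and power_R: "(\<Sum>i\<in>UNIV. P_used i) \<le> P_R"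
    and stable: "mean_square_stable M X"
    \<comment> \<open>water-filling powers\<close>
    and P_opt: "\<And>i. P_opt i = max (\<gamma> - Nd i / 2) 0"
    and \<gamma>: "(\<Sum>i\<in>UNIV. P_opt i) = P_R"
  shows "log 2 \<bar>det A\<bar> \<le>
    1 / 4 * min (log 2 (1 + 2 * (\<Sum>i\<in>UNIV. P_S / Nr i)))
                (\<Sum>i\<in>UNIV. log 2 (1 + 2 * P_opt i / Nd i))"
proof -
  interpret parallel_network M A B X U W Se Y Sr R Zr Zd f g \<pi> P_S Nr Nd P_used
    using assms by (intro parallel_network.intro parallel_network_axioms.intro) auto
  have sum_nn: "0 \<le> (\<Sum>i\<in>UNIV. 1 / Nr i)"
    using Nr_pos by (intro sum_nonneg) (auto simp: less_imp_le)
  have C1_eq: "1 + 2 * (\<Sum>i\<in>UNIV. P_S / Nr i) = 1 + 2 * P_S * (\<Sum>i\<in>UNIV. 1 / Nr i)"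
    by (simp add: sum_distrib_left)
  \<comment> \<open>The 1/4 is one half from the capacity of a use and one half from the two plant
    steps per use.\<close>
  have le1: "ln \<bar>det A\<bar> \<le> 1 / 4 * ln (1 + 2 * P_S * (\<Sum>i\<in>UNIV. 1 / Nr i))"
  proof (cases "det A = 0")
    \<comment> \<open>\<open>ln 0 = 0\<close> in HOL, so the claim is the nonnegativity of the right
      side.\<close>
    case True
    then show ?thesis
      using P_S_nonneg sum_nn by simp
  qed (use first_hop_bound in simp)
  have P_opt_nn: "0 \<le> P_opt i" for i
    by (simp add: P_opt)
  have le2: "ln \<bar>det A\<bar> \<le> 1 / 4 * (\<Sum>i\<in>UNIV. ln (1 + 2 * P_opt i / Nd i))"
  proof (cases "det A = 0")
    case True
    have "0 \<le> (\<Sum>i\<in>UNIV. ln (1 + 2 * P_opt i / Nd i))"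
      using P_opt_nn Nd_pos by (intro sum_nonneg ln_ge_zero) (auto simp: less_imp_le)
    with True show ?thesis by simp
  next
    case False
    \<comment> \<open>The water-filling powers exhaust the budget \<open>P_R\<close> and the powers
      in use stay within it, so the former dominate.\<close>
    have "(\<Sum>i\<in>UNIV. ln (1 + 2 * P_used i / Nd i)) \<le> (\<Sum>i\<in>UNIV. ln (1 + 2 * P_opt i / Nd i))"
      using power_R \<gamma> by (intro water_filling_optimal[OF Nd_pos P_used_nonneg P_opt]) simp
    with second_hop_bound[OF False] show ?thesis
      by (simp flip: sum_divide_distrib)
  qed
  have "log 2 \<bar>det A\<bar> \<le> 1 / 4 * log 2 (1 + 2 * (\<Sum>i\<in>UNIV. P_S / Nr i))"
    using le1 divide_right_mono[OF le1, of "ln 2"] unfolding C1_eq by (simp add: log_def)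
  moreover have "log 2 \<bar>det A\<bar> \<le> 1 / 4 * (\<Sum>i\<in>UNIV. log 2 (1 + 2 * P_opt i / Nd i))"
    using divide_right_mono[OF le2, of "ln 2"] by (simp add: log_def flip: sum_divide_distrib)
  ultimately show ?thesis
    by (simp add: min_def)
qed

end
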